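(* Let $s\in\{1,\dots,p\}$. Assume that the condition $SRE(s,7)$ holds for $\mathbb X$. Let $\hat{\boldsymbol\beta}$ be the Lasso estimator with a tuning parameter $\lambda$ satisfying $$\lambda\ge2(4+\sqrt2)\,\sigma\sqrt{\frac{\log(2ep/s)}n}.$$ Then $$\mathbb E\left[\frac\lambda2|\hat{\boldsymbol\beta}-\boldsymbol\beta|_1+\|\mathbb X\hat{\boldsymbol\beta}-\mathbf f\|_n^2\right]\le\|\mathbb X\boldsymbol\beta-\mathbf f\|_n^2+\frac{49\lambda^2s}{16}\left(\frac1{\theta^2(s,7)}+\frac1{2\log(2ep)}\right)$$ for all $\boldsymbol\beta\in\mathbb R^p$ such that $|\boldsymbol\beta|_0\le s$, and all $\mathbf f\in\mathbb R^n$. Furthermore, if $\mathbf f=\mathbb X\boldsymbol\beta^*$ for some $\boldsymbol\beta^*\in\mathbb R^p$ with $|\boldsymbol\beta^*|_0\le s$ then, for any $1\le q\le2$, $$\mathbb E\left[|\boldsymbol\beta^*-\hat{\boldsymbol\beta}|_q^q\right]\le\frac{49^q\lambda^qs}{8^q}\left(\frac1{\theta^{2q}(s,7)}+\frac1{(\log(2ep))^q}\right).$$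
   Context: Let $n,p\ge1$ be integers, $\sigma>0$, $\mathbb X\in\mathbb R^{n\times p}$ a deterministic matrix, $\mathbf f\in\mathbb R^n$ deterministic, $\boldsymbol\xi\sim\mathcal N(\mathbf 0,\sigma^2I_{n\times n})$, and $\mathbf y=\mathbf f+\boldsymbol\xi$. For $\boldsymbol u\in\mathbb R^n$, $\|\boldsymbol u\|_n^2=\frac1n\sum_{i=1}^nu_i^2$. $|\cdot|_q$ is the $\ell_q$ norm on $\mathbb R^p$, $|\boldsymbol\beta|_0$ is the number of nonzero components of $\boldsymbol\beta$, and $\boldsymbol e_1,\dots,\boldsymbol e_p$ is the canonical basis of $\mathbb R^p$. Lasso estimator with tuning parameter $\lambda>0$: any $\hat{\boldsymbol\beta}\in\arg\min_{\boldsymbol\beta\in\mathbb R^p}\big(\|\mathbb X\boldsymbol\beta-\mathbf y\|_n^2+2\lambda|\boldsymbol\beta|_1\big)$. Condition $SRE(s,c_0)$ ($c_0>0$): $\|\mathbb X\boldsymbol e_j\|_n\le1$ for all $j=1,\dots,p$, and $$\theta(s,c_0)=\min_{\boldsymbol\delta\in\mathcal C_{SRE}(s,c_0),\,\boldsymbol\delta\ne\mathbf 0}\frac{\|\mathbb X\boldsymbol\delta\|_n}{|\boldsymbol\delta|_2}>0,\qquad\mathcal C_{SRE}(s,c_0)=\{\boldsymbol\delta\in\mathbb R^p:|\boldsymbol\delta|_1\le(1+c_0)\sqrt s\,|\boldsymbol\delta|_2\}.$$ *)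

theory Defs
  imports "HOL-Probability.Probability"
begin

definition emp_norm :: "real ^ 'n \<Rightarrow> real" where
  "emp_norm u = sqrt ((\<Sum>i\<in>UNIV. (u $ i)\<^sup>2) / real CARD('n))"

definition lq_norm :: "real \<Rightarrow> real ^ 'p \<Rightarrow> real" where
  "lq_norm q x = (\<Sum>j\<in>UNIV. \<bar>x $ j\<bar> powr q) powr (1 / q)"

lemma lq_norm_1: "lq_norm 1 x = (\<Sum>j\<in>UNIV. \<bar>x $ j\<bar>)"
  by (simp add: lq_norm_def sum_nonneg)

text \<open>The \<open>\<ell>\<^sub>2\<close> norm is written \<^const>\<open>norm\<close> below.\<close>

lemma lq_norm_2: "lq_norm 2 x = norm x"
  by (simp add: lq_norm_def norm_vec_def L2_set_def powr_half_sqrt sum_nonneg)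

definition l0_norm :: "real ^ 'p \<Rightarrow> nat" where
  "l0_norm x = card {j. x $ j \<noteq> 0}"

definition is_lasso :: "real ^ 'p ^ 'n \<Rightarrow> real \<Rightarrow> real ^ 'n \<Rightarrow> real ^ 'p \<Rightarrow> bool" where
  "is_lasso X lam y b \<longleftrightarrow>
     is_arg_min (\<lambda>\<beta>. (emp_norm (X *v \<beta> - y))\<^sup>2 + 2 * lam * lq_norm 1 \<beta>) (\<lambda>_. True) b"

definition SRE_cone :: "nat \<Rightarrow> real \<Rightarrow> (real ^ 'p) set" where
  "SRE_cone s c0 = {\<delta>. lq_norm 1 \<delta> \<le> (1 + c0) * sqrt (real s) * norm \<delta>}"

text \<open>The infimum is a minimum, see \<open>SRE_theta_attained\<close>.\<close>

definition SRE_theta :: "real ^ 'p ^ 'n \<Rightarrow> nat \<Rightarrow> real \<Rightarrow> real" where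
  "SRE_theta X s c0 = (INF \<delta>\<in>SRE_cone s c0 - {0}. emp_norm (X *v \<delta>) / norm \<delta>)"

definition SRE :: "real ^ 'p ^ 'n \<Rightarrow> nat \<Rightarrow> real \<Rightarrow> bool" where
  "SRE X s c0 \<longleftrightarrow> (\<forall>j. emp_norm (X *v axis j 1) \<le> 1) \<and> SRE_theta X s c0 > 0"

lemma emp_norm_eq: "emp_norm (u :: real ^ 'n) = norm u / sqrt (real CARD('n))"
  by (simp add: emp_norm_def norm_vec_def L2_set_def real_sqrt_divide)

lemma SRE_theta_attained:
  fixes X :: "real ^ 'p ^ 'n"
  assumes "s \<ge> 1" "c0 > 0"
  shows "\<exists>\<delta>\<in>SRE_cone s c0 - {0}.
    SRE_theta X s c0 = emp_norm (X *v \<delta>) / norm \<delta> \<and>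
    (\<forall>\<delta>'\<in>SRE_cone s c0 - {0}. emp_norm (X *v \<delta>) / norm \<delta> \<le> emp_norm (X *v \<delta>') / norm \<delta>')"
proof -
  define g where "g = (\<lambda>\<delta> :: real ^ 'p. emp_norm (X *v \<delta>) / norm \<delta>)"
  define K where "K = (SRE_cone s c0 :: (real ^ 'p) set) \<inter> sphere 0 1"
  have "closed (SRE_cone s c0 :: (real ^ 'p) set)"
    unfolding SRE_cone_def lq_norm_1 by (intro closed_Collect_le continuous_intros)
  then have "compact K"
    unfolding K_def by (intro closed_Int_compact) auto
  moreover have "axis j 1 \<in> K" for j
  proof -
    have "(\<Sum>i\<in>UNIV. \<bar>(axis j 1 :: real ^ 'p) $ i\<bar>) = 1"
      by (simp add: axis_def if_distrib[of abs] cong: if_cong)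
    moreover have "1 * 1 \<le> (1 + c0) * sqrt (real s)"
      using assms by (intro mult_mono) auto
    ultimately show ?thesis
      by (simp add: K_def SRE_cone_def lq_norm_1)
  qed
  then have "K \<noteq> {}" by blast
  moreover have "continuous_on K g"
    unfolding g_def emp_norm_eq K_def
    by (intro continuous_intros linear_continuous_on
        linear_linear[THEN iffD2, OF matrix_vector_mul_linear]) auto
  ultimately obtain d where d: "d \<in> K" "\<And>x. x \<in> K \<Longrightarrow> g d \<le> g x"
    using continuous_attains_inf by metis
  have min: "g d \<le> g x" if x: "x \<in> SRE_cone s c0 - {0}" for x
  proof -
    define z where "z = (1 / norm x) *\<^sub>R x"
    have n: "norm x > 0" using x by simp
    have "lq_norm 1 z = lq_norm 1 x / norm x"
      using n by (simp add: z_def lq_norm_1 abs_mult sum_divide_distrib)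
    then have "z \<in> K"
      using x n by (simp add: K_def SRE_cone_def z_def divide_le_eq)
    moreover have "g z = g x"
      using n by (simp add: g_def z_def emp_norm_eq matrix_vector_mult_scaleR)
    ultimately show ?thesis using d(2) by metis
  qed
  have dm: "d \<in> SRE_cone s c0 - {0}"
    using d(1) by (auto simp: K_def)
  have "SRE_theta X s c0 = g d"
    unfolding SRE_theta_def g_def[symmetric]
    by (rule cInf_eq_minimum) (use dm min in auto)
  with dm min show ?thesis
    unfolding g_def by blast
qed

text \<open>\<open>\<xi> \<sim> N(0, \<sigma>\<^sup>2 I)\<close>; the second argument of \<^const>\<open>normal_density\<close> is the standard deviation.\<close>

definition gaussian_noise :: "'w measure \<Rightarrow> real \<Rightarrow> ('w \<Rightarrow> real ^ 'n) \<Rightarrow> bool" where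
  "gaussian_noise M \<sigma> \<xi> \<longleftrightarrow>
     prob_space.indep_vars M (\<lambda>_. borel) (\<lambda>i \<omega>. \<xi> \<omega> $ i) UNIV \<and>
     (\<forall>i. distributed M lborel (\<lambda>\<omega>. \<xi> \<omega> $ i) (normal_density 0 \<sigma>))"

end

theory Submission
  imports Defs
begin

text \<open>The error of the Lasso is controlled as soon as the noise term \<open>\<xi> \<bullet> (X *v u)\<close> is bounded for all directions
\<open>u\<close> at once, since \<open>u = \<beta>hat - \<beta>\<close> is random. Write \<open>|u|\<close> for the \<open>\<ell>\<^sub>1\<close> norm and \<open>L = ln (2 e p / s)\<close>. The bound used is

  \<open>\<xi> \<bullet> (X *v u) \<le> V / c + c \<sigma>\<^sup>2 \<parallel>X u\<parallel>\<^sup>2 / 2 + \<sigma> sqrt (2 n L) |u|\<close>  for all \<open>u\<close> and all \<open>c > 0\<close>,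

where the single random variable \<open>V \<ge> 0\<close> satisfies \<open>E exp V \<le> exp s\<close> (\<open>gaussian_uniform_bound\<close>). It plays the
role of a concentration inequality for a supremum of Gaussians, and it comes from an exact exponential
moment on a lattice. For a fixed \<open>u\<close> the functional
\<open>\<Phi> u = \<xi> \<bullet> (X *v u) - \<sigma>\<^sup>2 \<parallel>X u\<parallel>\<^sup>2 / 2 - (L / h) |u|\<close> satisfies \<open>E exp (\<Phi> u) = exp (- (L / h) |u|)\<close>, and on the lattice of
integer multiples of \<open>h\<close> these numbers have a finite sum, which factorises over the coordinates into a
power of a geometric series. So \<open>V\<close>, the logarithm of the sum of \<open>exp (\<Phi> u)\<close> over all lattice points,
has a bounded exponential moment and dominates \<open>\<Phi>\<close> on the lattice. A point off the lattice is
moved to it one coordinate at a time; \<open>\<Phi>\<close> is concave quadratic plus affine on each cell, so one of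
the two ends of the cell loses little, and the losses add up to a multiple of \<open>h |u|\<close> (\<open>penalised_rounding\<close>). Rescaling \<open>u\<close> gives the
free parameter \<open>c\<close>.

The rest is deterministic (\<open>lasso_pathwise_bound\<close>). Optimality of the Lasso bounds the prediction error by
the noise term and the \<open>\<ell>\<^sub>1\<close> difference of \<open>\<beta>\<close> and \<open>\<beta>hat\<close>, with the term \<open>\<parallel>X u\<parallel>\<^sup>2\<close> to spare. The \<open>\<ell>\<^sub>1\<close> part of the
noise bound is dominated by \<open>lam\<close>. Outside the cone of the restricted eigenvalue condition the mass of
\<open>u\<close> off the support of \<open>\<beta>\<close> makes the penalty terms negative; inside the cone they are at most a multiple
of \<open>lam * sqrt s * \<parallel>X u\<parallel> / \<theta>\<close>, absorbed by \<open>\<parallel>X u\<parallel>\<^sup>2\<close>. What remains is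
\<open>lam\<^sup>2 B\<close> with \<open>B = 13 s / (5 \<theta>\<^sup>2) + V / 20\<close>, and \<open>E V \<le> s \<le> s / \<theta>\<^sup>2\<close> gives the first claim.

If \<open>f = X *v \<beta>\<close>, the same estimate bounds \<open>|u|\<close> and \<open>\<parallel>X u\<parallel>\<close>, hence the Euclidean norm of \<open>u\<close> (\<open>l2_le_of_prediction_and_l1\<close>), and
\<open>sum_powr_le_l1_l2\<close> interpolates between the two norms for \<open>1 \<le> q \<le> 2\<close>. The Euclidean bound is quadratic in \<open>B\<close>, so
here the second moment of \<open>V\<close> enters as well.\<close>

section \<open>A bound on Gaussian noise uniform over all directions\<close>

text \<open>Completing the square: exponential tilting of a centred Gaussian density only moves its mean.\<close>

lemma gaussian_exp_tilt:
  fixes \<sigma> a x :: real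
  assumes "\<sigma> > 0"
  shows "normal_density 0 \<sigma> x * exp (a * x) = exp (\<sigma>\<^sup>2 * a\<^sup>2 / 2) * normal_density (a * \<sigma>\<^sup>2) \<sigma> x"
proof -
  have "- (x - 0)\<^sup>2 / (2 * \<sigma>\<^sup>2) + a * x = \<sigma>\<^sup>2 * a\<^sup>2 / 2 + - (x - a * \<sigma>\<^sup>2)\<^sup>2 / (2 * \<sigma>\<^sup>2)"
    using assms by (simp add: field_simps power2_eq_square)
  then show ?thesis
    by (simp add: normal_density_def mult_exp_exp)
qed

lemma (in prob_space) gaussian_mgf:
  fixes \<xi> :: "'a \<Rightarrow> real ^ 'n" and v :: "real ^ 'n"
  assumes "\<sigma> > 0" and noise: "gaussian_noise M \<sigma> \<xi>"
  shows "(\<integral>\<^sup>+\<omega>. ennreal (exp (\<xi> \<omega> \<bullet> v)) \<partial>M) = ennreal (exp (\<sigma>\<^sup>2 * (norm v)\<^sup>2 / 2))"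
proof -
  have one: "(\<integral>\<^sup>+\<omega>. ennreal (exp (v $ i * \<xi> \<omega> $ i)) \<partial>M) = ennreal (exp (\<sigma>\<^sup>2 * (v $ i)\<^sup>2 / 2))" for i
  proof -
    have "distributed M lborel (\<lambda>\<omega>. \<xi> \<omega> $ i) (normal_density 0 \<sigma>)"
      using noise by (auto simp: gaussian_noise_def)
    then have "(\<integral>\<^sup>+\<omega>. ennreal (exp (v $ i * \<xi> \<omega> $ i)) \<partial>M)
        = (\<integral>\<^sup>+x. ennreal (normal_density 0 \<sigma> x) * ennreal (exp (v $ i * x)) \<partial>lborel)"
      by (subst distributed_nn_integral) auto
    also have "\<dots> = (\<integral>\<^sup>+x. ennreal (exp (\<sigma>\<^sup>2 * (v $ i)\<^sup>2 / 2)) *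
        ennreal (normal_density (v $ i * \<sigma>\<^sup>2) \<sigma> x) \<partial>lborel)"
      by (intro nn_integral_cong)
        (simp add: ennreal_mult'[symmetric] gaussian_exp_tilt[OF \<open>\<sigma> > 0\<close>])
    also have "\<dots> = ennreal (exp (\<sigma>\<^sup>2 * (v $ i)\<^sup>2 / 2))"
      using \<open>\<sigma> > 0\<close> by (simp add: nn_integral_cmult nn_integral_eq_integral)
    finally show ?thesis .
  qed
  have "indep_vars (\<lambda>_. borel) (\<lambda>i \<omega>. ennreal (exp (v $ i * \<xi> \<omega> $ i))) UNIV"
    using noise unfolding gaussian_noise_def
    by (intro indep_vars_compose2[where X = "\<lambda>i \<omega>. \<xi> \<omega> $ i"
          and Y = "\<lambda>i x. ennreal (exp (v $ i * x))"]) auto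
  then have "(\<integral>\<^sup>+\<omega>. (\<Prod>i\<in>UNIV. ennreal (exp (v $ i * \<xi> \<omega> $ i))) \<partial>M)
      = (\<Prod>i\<in>UNIV. ennreal (exp (\<sigma>\<^sup>2 * (v $ i)\<^sup>2 / 2)))"
    by (subst indep_vars_nn_integral) (auto simp: one)
  also have "\<dots> = ennreal (exp (\<Sum>i\<in>UNIV. \<sigma>\<^sup>2 * (v $ i)\<^sup>2 / 2))"
    by (simp add: prod_ennreal exp_sum)
  also have "(\<Sum>i\<in>UNIV. \<sigma>\<^sup>2 * (v $ i)\<^sup>2 / 2) = \<sigma>\<^sup>2 * (norm v)\<^sup>2 / 2"
    by (simp add: norm_vec_def L2_set_def sum_nonneg sum_distrib_left sum_divide_distrib)
  finally show ?thesis
    by (simp add: prod_ennreal exp_sum[symmetric] inner_vec_def mult.commute)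
qed

text \<open>One coordinate of \<open>v\<close> lies in a cell with ends at distances \<open>a\<close> below and \<open>b\<close> above it. Weighting the two
ends by \<open>b / h\<close> and \<open>a / h\<close> keeps the mean of the coordinate, so in the average of \<open>\<Phi>\<close> the linear terms
cancel and only the quadratic term loses, namely a multiple of \<open>a * b\<close>. The end nearer to zero
is at distance at most \<open>\<bar>v $ j\<bar>\<close>, hence \<open>a * b \<le> h * \<bar>v $ j\<bar>\<close>. The better end is at least as good as the average.\<close>

lemma penalised_rounding_coordinate:
  fixes A :: "real ^ 'p ^ 'n" and g v :: "real ^ 'p" and c d h :: real
  defines "\<Phi> \<equiv> \<lambda>u. g \<bullet> u - (norm (A *v u))\<^sup>2 / 2 - c * (\<Sum>i\<in>UNIV. \<bar>u $ i\<bar>)"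
  assumes col: "(norm (A *v axis j 1))\<^sup>2 \<le> d" and "h > 0"
  shows "\<exists>t k. v $ j + t = h * of_int k \<and>
    \<Phi> v \<le> \<Phi> (v + t *\<^sub>R axis j 1) + d * h * \<bar>v $ j\<bar> / 2"
proof -
  define e where "e = (axis j 1 :: real ^ 'p)"
  define k where "k = \<lfloor>v $ j / h\<rfloor>"
  define a b where "a = v $ j - h * of_int k" and "b = h * of_int (k + 1) - v $ j"
  have "of_int k \<le> v $ j / h" "v $ j / h < of_int k + 1"
    unfolding k_def by linarith+
  then have ab: "a \<ge> 0" "b > 0" "a + b = h"
    using \<open>h > 0\<close> by (auto simp: a_def b_def field_simps)
  have l1: "(\<Sum>i\<in>UNIV. \<bar>(v + t *\<^sub>R e) $ i\<bar>) = (\<Sum>i\<in>UNIV. \<bar>v $ i\<bar>) + (\<bar>v $ j + t\<bar> - \<bar>v $ j\<bar>)" for t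
  proof -
    have "(\<Sum>i\<in>UNIV. \<bar>(v + t *\<^sub>R e) $ i\<bar>)
        = (\<Sum>i\<in>UNIV. \<bar>v $ i\<bar> + (if i = j then \<bar>v $ j + t\<bar> - \<bar>v $ j\<bar> else 0))"
      by (intro sum.cong) (auto simp: e_def axis_def)
    then show ?thesis
      by (simp add: sum.distrib)
  qed
  have exp: "\<Phi> (v + t *\<^sub>R e) = \<Phi> v + t * (g \<bullet> e - (A *v v) \<bullet> (A *v e))
      - t\<^sup>2 * (norm (A *v e))\<^sup>2 / 2 - c * (\<bar>v $ j + t\<bar> - \<bar>v $ j\<bar>)" for t
  proof -
    have "(norm (A *v (v + t *\<^sub>R e)))\<^sup>2
        = (norm (A *v v))\<^sup>2 + 2 * t * ((A *v v) \<bullet> (A *v e)) + t\<^sup>2 * (norm (A *v e))\<^sup>2"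
      unfolding power2_norm_eq_inner matrix_vector_right_distrib matrix_vector_mult_scaleR
        inner_add_left inner_add_right inner_scaleR_left inner_scaleR_right
        inner_commute[of "A *v e" "A *v v"] by algebra
    then show ?thesis
      unfolding \<Phi>_def l1 by (simp add: inner_add_right right_diff_distrib distrib_left add_divide_distrib)
  qed
  \<comment> \<open>Zero is a grid point, so the absolute value is affine on the cell containing \<open>v $ j\<close>.\<close>
  have k_cases: "k \<ge> 0 \<or> k + 1 \<le> 0" by linarith
  have abs: "b * \<bar>v $ j - a\<bar> + a * \<bar>v $ j + b\<bar> = h * \<bar>v $ j\<bar> \<and> a * b \<le> h * \<bar>v $ j\<bar>"
    using k_cases
  proof
    assume "k \<ge> 0"
    then have "h * of_int k \<ge> 0" using \<open>h > 0\<close> by simp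
    then have nn: "v $ j - a \<ge> 0" "v $ j \<ge> a" by (simp_all add: a_def)
    have "a * b \<le> v $ j * h"
      using nn ab by (intro mult_mono) auto
    then show ?thesis
      using nn ab(1,2) by (simp add: algebra_simps flip: ab(3))
  next
    assume "k + 1 \<le> 0"
    then have "h * of_int (k + 1) \<le> 0" using \<open>h > 0\<close> by (simp add: mult_le_0_iff del: of_int_add)
    then have np: "v $ j + b \<le> 0" "b \<le> - v $ j" by (simp_all add: b_def)
    have "a * b \<le> h * (- v $ j)"
      using np ab by (intro mult_mono) auto
    moreover have "\<bar>v $ j - a\<bar> = a - v $ j" "\<bar>v $ j + b\<bar> = - v $ j - b" "\<bar>v $ j\<bar> = - v $ j"
      using np ab by auto
    ultimately show ?thesis
      by (simp add: algebra_simps flip: ab(3))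
  qed
  have avg: "b * \<Phi> (v + (- a) *\<^sub>R e) + a * \<Phi> (v + b *\<^sub>R e)
      = h * (\<Phi> v - a * b * (norm (A *v e))\<^sup>2 / 2)"
  proof -
    have "b * \<Phi> (v + (- a) *\<^sub>R e) + a * \<Phi> (v + b *\<^sub>R e)
      = (a + b) * (\<Phi> v - a * b * (norm (A *v e))\<^sup>2 / 2)
        - c * (b * \<bar>v $ j - a\<bar> + a * \<bar>v $ j + b\<bar> - (a + b) * \<bar>v $ j\<bar>)"
      unfolding exp by (simp add: algebra_simps power2_eq_square add_divide_distrib)
    then show ?thesis using abs ab by simp
  qed
  have loss: "a * b * (norm (A *v e))\<^sup>2 \<le> d * h * \<bar>v $ j\<bar>"
    using mult_mono[of "a * b" "h * \<bar>v $ j\<bar>" "(norm (A *v e))\<^sup>2" d] abs ab col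
    by (simp add: e_def algebra_simps)
  show ?thesis
  proof (rule ccontr)
    assume "\<not> ?thesis"
    then have neg: "\<Phi> (v + t *\<^sub>R e) < \<Phi> v - d * h * \<bar>v $ j\<bar> / 2" if "v $ j + t = h * of_int i" for t i
      using that unfolding e_def by force
    have "\<Phi> (v + (- a) *\<^sub>R e) < \<Phi> v - d * h * \<bar>v $ j\<bar> / 2"
      using neg[of "- a" k] by (simp add: a_def)
    moreover have "\<Phi> (v + b *\<^sub>R e) < \<Phi> v - d * h * \<bar>v $ j\<bar> / 2"
      using neg[of b "k + 1"] by (simp add: b_def)
    ultimately have "b * \<Phi> (v + (- a) *\<^sub>R e) + a * \<Phi> (v + b *\<^sub>R e)
        < b * (\<Phi> v - d * h * \<bar>v $ j\<bar> / 2) + a * (\<Phi> v - d * h * \<bar>v $ j\<bar> / 2)"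
      using ab by (intro add_less_le_mono mult_strict_left_mono mult_left_mono) auto
    also have "\<dots> = h * (\<Phi> v - d * h * \<bar>v $ j\<bar> / 2)"
      by (metis ab(3) add.commute distrib_right)
    also have "\<dots> \<le> h * (\<Phi> v - a * b * (norm (A *v e))\<^sup>2 / 2)"
      using loss \<open>h > 0\<close> by (intro mult_left_mono) auto
    finally show False using avg by simp
  qed
qed

text \<open>Rounding coordinate after coordinate. The loss at coordinate \<open>j\<close> is governed by the current value of
that coordinate, which is still \<open>u $ j\<close>, so the losses add up to a multiple of the \<open>\<ell>\<^sub>1\<close> norm of \<open>u\<close>.\<close>

lemma penalised_rounding:
  fixes A :: "real ^ 'p ^ 'n" and g u :: "real ^ 'p" and c d h :: real
  defines "\<Phi> \<equiv> \<lambda>u. g \<bullet> u - (norm (A *v u))\<^sup>2 / 2 - c * (\<Sum>i\<in>UNIV. \<bar>u $ i\<bar>)"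
  assumes col: "\<And>j. (norm (A *v axis j 1))\<^sup>2 \<le> d" and "h > 0"
  shows "\<exists>k :: 'p \<Rightarrow> int. \<Phi> u \<le> \<Phi> (\<chi> j. h * of_int (k j)) + d * h * (\<Sum>i\<in>UNIV. \<bar>u $ i\<bar>) / 2"
proof -
  have "\<exists>v. (\<forall>j\<in>J. \<exists>k. v $ j = h * of_int k) \<and> (\<forall>j. j \<notin> J \<longrightarrow> v $ j = u $ j) \<and>
      \<Phi> u \<le> \<Phi> v + d * h * (\<Sum>i\<in>J. \<bar>u $ i\<bar>) / 2" for J
  proof (induction J rule: infinite_finite_induct)
    case (insert j J)
    then obtain v where v: "\<forall>j\<in>J. \<exists>k. v $ j = h * of_int k" "\<forall>j. j \<notin> J \<longrightarrow> v $ j = u $ j"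
      "\<Phi> u \<le> \<Phi> v + d * h * (\<Sum>i\<in>J. \<bar>u $ i\<bar>) / 2" by blast
    obtain t k where tk: "v $ j + t = h * of_int k"
      "\<Phi> v \<le> \<Phi> (v + t *\<^sub>R axis j 1) + d * h * \<bar>v $ j\<bar> / 2"
      using penalised_rounding_coordinate[OF col \<open>h > 0\<close>, where v = v and g = g and c = c and j = j]
      unfolding \<Phi>_def by blast
    show ?case
    proof (intro exI[of _ "v + t *\<^sub>R axis j 1"] conjI ballI allI impI)
      fix i assume "i \<in> insert j J"
      then show "\<exists>k. (v + t *\<^sub>R axis j 1) $ i = h * of_int k"
        using v(1) tk(1) insert(2) by (cases "i = j") (auto simp: axis_def)
    next
      fix i assume "i \<notin> insert j J"
      then show "(v + t *\<^sub>R axis j 1) $ i = u $ i"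
        using v(2) by (auto simp: axis_def)
    next
      have "v $ j = u $ j" using v(2) insert(2) by blast
      then show "\<Phi> u \<le> \<Phi> (v + t *\<^sub>R axis j 1) + d * h * (\<Sum>i\<in>insert j J. \<bar>u $ i\<bar>) / 2"
        using v(3) tk(2) insert(1,2) by (simp add: algebra_simps add_divide_distrib)
    qed
  qed auto
  from this[of UNIV] obtain v where v: "\<forall>j. \<exists>k. v $ j = h * of_int k"
    "\<Phi> u \<le> \<Phi> v + d * h * (\<Sum>i\<in>UNIV. \<bar>u $ i\<bar>) / 2" by auto
  from v(1) obtain k where "\<And>j. v $ j = h * of_int (k j)" by metis
  then have "v = (\<chi> j. h * of_int (k j))" by (simp add: vec_eq_iff)
  with v(2) show ?thesis by blast
qed

lemma sum_power_abs_int_le: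
  fixes x :: real
  assumes "0 < x" "x < 1"
  shows "(\<Sum>k\<in>{- int N..int N}. x ^ nat \<bar>k\<bar>) \<le> (1 + x) / (1 - x)"
proof -
  have "(\<Sum>k\<in>{- int N..int N}. x ^ nat \<bar>k\<bar>) = (1 + x - 2 * x ^ Suc N) / (1 - x)"
  proof (induction N)
    case (Suc N)
    have "{- int (Suc N)..int (Suc N)} = insert (int (Suc N)) (insert (- int (Suc N)) {- int N..int N})"
      by auto
    then have "(\<Sum>k\<in>{- int (Suc N)..int (Suc N)}. x ^ nat \<bar>k\<bar>)
        = 2 * x ^ Suc N + (\<Sum>k\<in>{- int N..int N}. x ^ nat \<bar>k\<bar>)"
      by (simp add: nat_add_distrib)
    also have "\<dots> = (1 + x - 2 * x ^ Suc (Suc N)) / (1 - x)"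
      unfolding Suc using assms by (simp add: field_simps)
    finally show ?case .
  qed (use assms in \<open>simp add: field_simps\<close>)
  also have "\<dots> \<le> (1 + x) / (1 - x)"
    using assms by (intro divide_right_mono) auto
  finally show ?thesis .
qed

text \<open>The bound on all directions described above, for columns of squared length at most \<open>d\<close>. The parameter
\<open>x\<close> is the ratio of the geometric series: a lattice point \<open>h * k\<close> gets the weight \<open>x ^ (\<Sum>j. \<bar>k j\<bar>)\<close>. A smaller \<open>x\<close>
lowers the exponential moment of \<open>V\<close> and raises the coefficient of the \<open>\<ell>\<^sub>1\<close> norm.\<close>

lemma (in prob_space) gaussian_uniform_bound:
  fixes X :: "real ^ 'p ^ 'n" and \<xi> :: "'a \<Rightarrow> real ^ 'n" and \<sigma> d x :: real
  assumes "\<sigma> > 0" and noise: "gaussian_noise M \<sigma> \<xi>"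
    and col: "\<And>j. (norm (X *v axis j 1))\<^sup>2 \<le> d" and "d > 0" and x: "0 < x" "x < 1"
  obtains V where "V \<in> borel_measurable M" "\<And>\<omega>. V \<omega> \<ge> 0"
    "(\<integral>\<^sup>+\<omega>. ennreal (exp (V \<omega>)) \<partial>M) \<le> ennreal (((1 + x) / (1 - x)) ^ CARD('p))"
    "AE \<omega> in M. \<forall>u c. c > 0 \<longrightarrow> \<xi> \<omega> \<bullet> (X *v u) \<le> V \<omega> / c
        + c * \<sigma>\<^sup>2 * (norm (X *v u))\<^sup>2 / 2 + \<sigma> * sqrt (2 * d * ln (1 / x)) * (\<Sum>i\<in>UNIV. \<bar>u $ i\<bar>)"
proof -
  define L where "L = ln (1 / x)"
  have "L > 0" using x by (simp add: L_def)
  \<comment> \<open>The \<open>\<ell>\<^sub>1\<close> coefficient is \<open>L / h\<close> from the weights plus \<open>\<sigma>\<^sup>2 * d * h / 2\<close> from rounding; this mesh balances them.\<close>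
  define h where "h = sqrt (2 * L / d) / \<sigma>"
  have "h > 0" using \<open>L > 0\<close> \<open>d > 0\<close> \<open>\<sigma> > 0\<close> by (simp add: h_def)
  have h2: "\<sigma>\<^sup>2 * d * h\<^sup>2 = 2 * L"
    using \<open>L > 0\<close> \<open>d > 0\<close> \<open>\<sigma> > 0\<close> by (simp add: h_def power_divide)
  define \<Phi> where "\<Phi> \<omega> u = \<xi> \<omega> \<bullet> (X *v u) - \<sigma>\<^sup>2 * (norm (X *v u))\<^sup>2 / 2
      - L / h * (\<Sum>i\<in>UNIV. \<bar>u $ i\<bar>)" for \<omega> and u :: "real ^ 'p"
  define pt where "pt k = (\<chi> j. h * real_of_int (k j))" for k :: "'p \<Rightarrow> int"
  \<comment> \<open>The sum over the lattice is taken as the supremum of the sums over finite boxes.\<close>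
  define B where "B N = (PiE UNIV (\<lambda>_. {- int N..int N}) :: ('p \<Rightarrow> int) set)" for N
  define F where "F N \<omega> = (\<Sum>k\<in>B N. ennreal (exp (\<Phi> \<omega> (pt k))))" for N \<omega>
  define S where "S \<omega> = (SUP N. F N \<omega>)" for \<omega>
  have finB: "finite (B N)" for N
    unfolding B_def by (intro finite_PiE) auto
  have xi_meas [measurable]: "(\<lambda>\<omega>. \<xi> \<omega> \<bullet> v) \<in> borel_measurable M" for v
  proof -
    have "(\<lambda>\<omega>. \<xi> \<omega> $ i) \<in> borel_measurable M" for i
      using noise unfolding gaussian_noise_def by (auto dest!: distributed_measurable)
    then show ?thesis
      unfolding inner_vec_def by simp
  qed
  have \<Phi>_meas [measurable]: "(\<lambda>\<omega>. \<Phi> \<omega> u) \<in> borel_measurable M" for u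
    unfolding \<Phi>_def by simp
  have F_meas [measurable]: "F N \<in> borel_measurable M" for N
    unfolding F_def by simp
  have S_meas [measurable]: "S \<in> borel_measurable M"
    unfolding S_def by simp
  have incF: "incseq F"
  proof (rule incseq_SucI, rule le_funI)
    fix N \<omega>
    have "B N \<subseteq> B (Suc N)" unfolding B_def by (intro PiE_mono) auto
    then show "F N \<omega> \<le> F (Suc N) \<omega>"
      unfolding F_def by (intro sum_mono2 finB) auto
  qed

  have expect_weight: "(\<integral>\<^sup>+\<omega>. ennreal (exp (\<Phi> \<omega> (pt k))) \<partial>M) = ennreal (\<Prod>j\<in>UNIV. x ^ nat \<bar>k j\<bar>)" for k
  proof -
    let ?v = "X *v pt k"
    have pen: "exp (- (L / h * (\<Sum>i\<in>UNIV. \<bar>pt k $ i\<bar>))) = (\<Prod>j\<in>UNIV. x ^ nat \<bar>k j\<bar>)"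
    proof -
      have "x ^ nat \<bar>k j\<bar> = exp (- (L / h * \<bar>pt k $ j\<bar>))" for j
      proof -
        have "x ^ nat \<bar>k j\<bar> = exp (- L) ^ nat \<bar>k j\<bar>"
          using x by (simp add: L_def ln_div)
        also have "\<dots> = exp (- (L * \<bar>real_of_int (k j)\<bar>))"
          by (simp add: exp_of_nat_mult[symmetric] mult.commute)
        also have "L * \<bar>real_of_int (k j)\<bar> = L / h * \<bar>pt k $ j\<bar>"
          using \<open>h > 0\<close> by (simp add: pt_def abs_mult)
        finally show ?thesis .
      qed
      then show ?thesis
        by (simp add: sum_distrib_left exp_sum[symmetric] sum_negf)
    qed
    have "(\<integral>\<^sup>+\<omega>. ennreal (exp (\<Phi> \<omega> (pt k))) \<partial>M)
        = (\<integral>\<^sup>+\<omega>. ennreal (exp (\<xi> \<omega> \<bullet> ?v)) * ennreal (exp (- (\<sigma>\<^sup>2 * (norm ?v)\<^sup>2 / 2))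
            * exp (- (L / h * (\<Sum>i\<in>UNIV. \<bar>pt k $ i\<bar>)))) \<partial>M)"
      by (intro nn_integral_cong) (simp add: \<Phi>_def ennreal_mult'[symmetric] mult_exp_exp)
    also have "\<dots> = ennreal (exp (\<sigma>\<^sup>2 * (norm ?v)\<^sup>2 / 2)) * ennreal (exp (- (\<sigma>\<^sup>2 * (norm ?v)\<^sup>2 / 2))
            * exp (- (L / h * (\<Sum>i\<in>UNIV. \<bar>pt k $ i\<bar>))))"
      by (subst nn_integral_multc) (simp_all add: gaussian_mgf[OF \<open>\<sigma> > 0\<close> noise])
    also have "\<dots> = ennreal (exp (- (L / h * (\<Sum>i\<in>UNIV. \<bar>pt k $ i\<bar>))))"
      by (simp add: ennreal_mult'[symmetric] mult_exp_exp)
    finally show ?thesis unfolding pen .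
  qed
  have expect_F: "(\<integral>\<^sup>+\<omega>. F N \<omega> \<partial>M) \<le> ennreal (((1 + x) / (1 - x)) ^ CARD('p))" for N
  proof -
    have "(\<integral>\<^sup>+\<omega>. F N \<omega> \<partial>M) = (\<Sum>k\<in>B N. ennreal (\<Prod>j\<in>UNIV. x ^ nat \<bar>k j\<bar>))"
      unfolding F_def by (subst nn_integral_sum) (simp_all add: expect_weight)
    also have "\<dots> = ennreal (\<Sum>k\<in>B N. \<Prod>j\<in>UNIV. x ^ nat \<bar>k j\<bar>)"
      using x by (intro sum_ennreal prod_nonneg) auto
    also have "(\<Sum>k\<in>B N. \<Prod>j\<in>UNIV. x ^ nat \<bar>k j\<bar>)
        = (\<Prod>j\<in>(UNIV :: 'p set). \<Sum>k\<in>{- int N..int N}. x ^ nat \<bar>k\<bar>)"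
      unfolding B_def by (subst prod_sum_PiE) auto
    also have "ennreal \<dots> \<le> ennreal (((1 + x) / (1 - x)) ^ CARD('p))"
      using sum_power_abs_int_le[OF x] x
      by (auto intro!: ennreal_leI power_mono sum_nonneg)
    finally show ?thesis .
  qed
  have expect_S: "(\<integral>\<^sup>+\<omega>. S \<omega> \<partial>M) \<le> ennreal (((1 + x) / (1 - x)) ^ CARD('p))"
    unfolding S_def by (subst nn_integral_monotone_convergence_SUP[OF incF]) (auto intro: SUP_least expect_F)
  have S_fin: "AE \<omega> in M. S \<omega> \<noteq> \<infinity>"
    using expect_S by (intro nn_integral_noteq_infinite) (auto simp: top_unique)

  have point_le: "ennreal (exp (\<Phi> \<omega> (pt k))) \<le> S \<omega>" for \<omega> k
  proof -
    define N where "N = nat (Max (range (\<lambda>j. \<bar>k j\<bar>)))"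
    have "\<bar>k j\<bar> \<le> Max (range (\<lambda>j. \<bar>k j\<bar>))" for j
      by (rule Max_ge) auto
    then have bd: "\<bar>k j\<bar> \<le> int N" for j
      unfolding N_def by (meson nat_le_iff order_refl order_trans int_nat_eq of_nat_le_iff nat_le_eq_zle)
    have "k \<in> B N" using bd by (auto simp: B_def abs_le_iff) (metis minus_le_iff)
    then have "ennreal (exp (\<Phi> \<omega> (pt k))) \<le> F N \<omega>"
      unfolding F_def by (intro member_le_sum finB) auto
    also have "\<dots> \<le> S \<omega>" unfolding S_def by (intro SUP_upper) auto
    finally show ?thesis .
  qed
  \<comment> \<open>Where \<open>S\<close> is finite this is \<open>ln S\<close>, because the lattice point zero makes \<open>S \<ge> 1\<close>. On the null set where \<open>S\<close>
    is infinite, \<open>enn2real\<close> is zero and the maximum keeps \<open>V\<close> nonnegative.\<close>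
  define V where "V \<omega> = ln (max 1 (enn2real (S \<omega>)))" for \<omega>
  have V_meas: "V \<in> borel_measurable M" unfolding V_def by measurable
  have V_nonneg: "V \<omega> \<ge> 0" for \<omega> by (simp add: V_def)
  have S_ge_1: "1 \<le> S \<omega>" for \<omega>
    using point_le[of \<omega> "\<lambda>_. 0"] by (simp add: \<Phi>_def pt_def zero_vec_def[symmetric])
  have "ennreal (exp (V \<omega>)) \<le> S \<omega>" for \<omega>
  proof (cases "S \<omega>")
    case (real r)
    then show ?thesis using S_ge_1[of \<omega>] by (auto simp: V_def max_def)
  qed simp
  then have expect_V: "(\<integral>\<^sup>+\<omega>. ennreal (exp (V \<omega>)) \<partial>M) \<le> ennreal (((1 + x) / (1 - x)) ^ CARD('p))"
    by (intro order_trans[OF nn_integral_mono expect_S])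

  have bound: "\<xi> \<omega> \<bullet> (X *v u) \<le> V \<omega> / c + c * \<sigma>\<^sup>2 * (norm (X *v u))\<^sup>2 / 2
      + \<sigma> * sqrt (2 * d * L) * (\<Sum>i\<in>UNIV. \<bar>u $ i\<bar>)"
    if "S \<omega> \<noteq> \<infinity>" "c > 0" for \<omega> c u
  proof -
    have lattice: "\<Phi> \<omega> (pt k) \<le> V \<omega>" for k
    proof -
      have "exp (\<Phi> \<omega> (pt k)) \<le> enn2real (S \<omega>)"
        using enn2real_mono[OF point_le[of \<omega> k]] \<open>S \<omega> \<noteq> \<infinity>\<close> by (simp add: less_top)
      then have "exp (\<Phi> \<omega> (pt k)) \<le> max 1 (enn2real (S \<omega>))" by simp
      then show ?thesis
        unfolding V_def by (simp add: ln_ge_iff)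
    qed
    have A: "(\<sigma> *\<^sub>R X) *v v = \<sigma> *\<^sub>R (X *v v)" for v
      by (simp add: scaleR_matrix_vector_assoc)
    have g: "(transpose X *v \<xi> \<omega>) \<bullet> v = \<xi> \<omega> \<bullet> (X *v v)" for v
      by (simp add: dot_lmul_matrix transpose_matrix_vector)
    have "\<exists>k :: 'p \<Rightarrow> int. \<Phi> \<omega> v \<le> \<Phi> \<omega> (pt k) + (\<sigma>\<^sup>2 * d) * h * (\<Sum>i\<in>UNIV. \<bar>v $ i\<bar>) / 2" for v
      using penalised_rounding[of "\<sigma> *\<^sub>R X" "\<sigma>\<^sup>2 * d" h "transpose X *v \<xi> \<omega>" v "L / h"] col \<open>h > 0\<close>
      unfolding A g \<Phi>_def pt_def by (simp add: power_mult_distrib mult_left_mono)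
    then have all: "\<Phi> \<omega> v \<le> V \<omega> + (\<sigma>\<^sup>2 * d) * h * (\<Sum>i\<in>UNIV. \<bar>v $ i\<bar>) / 2" for v
      using lattice by (meson add_right_mono order_trans)
    have rate: "L / h + \<sigma>\<^sup>2 * d * h / 2 = \<sigma> * sqrt (2 * d * L)"
    proof -
      have e1: "L / h = \<sigma>\<^sup>2 * d * h / 2"
        using h2 \<open>h > 0\<close> by (simp add: field_simps power2_eq_square)
      have e2: "\<sigma>\<^sup>2 * d * h = \<sigma> * (d * sqrt (2 * L / d))"
        using \<open>\<sigma> > 0\<close> by (simp add: h_def power2_eq_square)
      have e3: "d * sqrt (2 * L / d) = sqrt (2 * d * L)"
        using \<open>d > 0\<close> by (simp add: real_sqrt_divide real_sqrt_mult real_div_sqrt field_simps)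
      show ?thesis using e1 e2[unfolded e3] by linarith
    qed
    \<comment> \<open>The estimate \<open>all\<close> is not homogeneous in \<open>u\<close>; applying it to \<open>c *\<^sub>R u\<close> produces the free parameter.\<close>
    let ?l = "\<Sum>i\<in>UNIV. \<bar>u $ i\<bar>"
    have "\<Phi> \<omega> (c *\<^sub>R u) = c * (\<xi> \<omega> \<bullet> (X *v u)) - \<sigma>\<^sup>2 * (c\<^sup>2 * (norm (X *v u))\<^sup>2) / 2 - L / h * (c * ?l)"
      using \<open>c > 0\<close> by (simp add: \<Phi>_def matrix_vector_mult_scaleR power_mult_distrib abs_mult sum_distrib_left)
    moreover have "(\<Sum>i\<in>UNIV. \<bar>(c *\<^sub>R u) $ i\<bar>) = c * ?l"
      using \<open>c > 0\<close> by (simp add: abs_mult sum_distrib_left)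
    ultimately have "c * (\<xi> \<omega> \<bullet> (X *v u)) \<le> V \<omega> + c\<^sup>2 * \<sigma>\<^sup>2 * (norm (X *v u))\<^sup>2 / 2
        + (L / h + \<sigma>\<^sup>2 * d * h / 2) * (c * ?l)"
      using all[of "c *\<^sub>R u"] by (simp add: algebra_simps)
    also have "\<dots> = c * (V \<omega> / c + c * \<sigma>\<^sup>2 * (norm (X *v u))\<^sup>2 / 2 + \<sigma> * sqrt (2 * d * L) * ?l)"
      unfolding rate using \<open>c > 0\<close> by (simp add: algebra_simps power2_eq_square)
    finally show ?thesis using \<open>c > 0\<close> by simp
  qed
  have "AE \<omega> in M. \<forall>u c. c > 0 \<longrightarrow> \<xi> \<omega> \<bullet> (X *v u) \<le> V \<omega> / c
        + c * \<sigma>\<^sup>2 * (norm (X *v u))\<^sup>2 / 2 + \<sigma> * sqrt (2 * d * ln (1 / x)) * (\<Sum>i\<in>UNIV. \<bar>u $ i\<bar>)"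
    using S_fin bound unfolding L_def[symmetric] by (auto elim!: eventually_mono)
  with V_meas V_nonneg expect_V show ?thesis by (rule that)
qed

section \<open>Deterministic analysis of the Lasso\<close>

lemma emp_norm_square: "(emp_norm (u :: real ^ 'n))\<^sup>2 = (norm u)\<^sup>2 / real CARD('n)"
  by (simp add: emp_norm_eq power_divide)

text \<open>The variational inequality at the minimiser: compare \<open>b\<close> with points of the segment towards \<open>\<beta>\<close>, use
convexity of the \<open>\<ell>\<^sub>1\<close> norm, and let the step tend to zero.\<close>

lemma lasso_first_order:
  fixes X :: "real ^ 'p ^ 'n"
  assumes lasso: "is_lasso X lam y b" and "lam \<ge> 0"
  shows "(X *v b - y) \<bullet> (X *v (b - \<beta>)) \<le> real CARD('n) * lam * (lq_norm 1 \<beta> - lq_norm 1 b)"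
proof -
  define n where "n = real CARD('n)"
  have "n > 0" by (simp add: n_def)
  define u where "u = b - \<beta>"
  let ?e = "2 * n * lam * (lq_norm 1 \<beta> - lq_norm 1 b)"
  have step: "2 * ((X *v b - y) \<bullet> (X *v u)) \<le> ?e + t * (norm (X *v u))\<^sup>2" if "0 < t" "t \<le> 1" for t
  proof -
    have conv: "lq_norm 1 (b - t *\<^sub>R u) \<le> (1 - t) * lq_norm 1 b + t * lq_norm 1 \<beta>"
    proof -
      have "\<bar>(b - t *\<^sub>R u) $ j\<bar> \<le> (1 - t) * \<bar>b $ j\<bar> + t * \<bar>\<beta> $ j\<bar>" for j
      proof -
        have "(b - t *\<^sub>R u) $ j = (1 - t) * b $ j + t * \<beta> $ j"
          by (simp add: u_def algebra_simps)
        then show ?thesis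
          using abs_triangle_ineq[of "(1 - t) * b $ j" "t * \<beta> $ j"] that by (simp add: abs_mult)
      qed
      then show ?thesis
        unfolding lq_norm_1 sum_distrib_left sum.distrib[symmetric] by (intro sum_mono)
    qed
    have "(emp_norm (X *v b - y))\<^sup>2 + 2 * lam * lq_norm 1 b
        \<le> (emp_norm (X *v (b - t *\<^sub>R u) - y))\<^sup>2 + 2 * lam * lq_norm 1 (b - t *\<^sub>R u)"
      using lasso by (auto simp: is_lasso_def is_arg_min_def not_less)
    also have "\<dots> \<le> (emp_norm (X *v (b - t *\<^sub>R u) - y))\<^sup>2
        + 2 * lam * ((1 - t) * lq_norm 1 b + t * lq_norm 1 \<beta>)"
      using conv \<open>lam \<ge> 0\<close> by (intro add_left_mono mult_left_mono) auto
    finally have "n * (emp_norm (X *v b - y))\<^sup>2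
        \<le> n * ((emp_norm (X *v (b - t *\<^sub>R u) - y))\<^sup>2 + 2 * lam * (t * (lq_norm 1 \<beta> - lq_norm 1 b)))"
      using \<open>n > 0\<close> by (intro mult_left_mono) (auto simp: algebra_simps)
    then have "(norm (X *v b - y))\<^sup>2 \<le> (norm (X *v (b - t *\<^sub>R u) - y))\<^sup>2 + t * ?e"
      unfolding emp_norm_square n_def[symmetric] using \<open>n > 0\<close> by (simp add: distrib_left) (simp add: algebra_simps)
    also have "X *v (b - t *\<^sub>R u) - y = (X *v b - y) - t *\<^sub>R (X *v u)"
      by (simp add: matrix_vector_mult_diff_distrib matrix_vector_mult_scaleR)
    also have "(norm ((X *v b - y) - t *\<^sub>R (X *v u)))\<^sup>2
        = (norm (X *v b - y))\<^sup>2 - 2 * t * ((X *v b - y) \<bullet> (X *v u)) + t * t * (norm (X *v u))\<^sup>2"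
      unfolding power2_norm_eq_inner inner_diff_left[of _ "t *\<^sub>R (X *v u)"]
        inner_diff_right[of _ _ "t *\<^sub>R (X *v u)"] inner_scaleR_left inner_scaleR_right
        inner_commute[of "X *v u" "X *v b - y"] by algebra
    finally have "t * (2 * ((X *v b - y) \<bullet> (X *v u))) \<le> t * (?e + t * (norm (X *v u))\<^sup>2)"
      by (simp add: algebra_simps)
    then show ?thesis using \<open>0 < t\<close> by simp
  qed
  have "2 * ((X *v b - y) \<bullet> (X *v u)) \<le> ?e"
  proof (rule field_le_epsilon)
    fix \<epsilon> :: real assume "\<epsilon> > 0"
    define t where "t = min 1 (\<epsilon> / ((norm (X *v u))\<^sup>2 + 1))"
    have pos: "(norm (X *v u))\<^sup>2 + 1 > 0" by (simp add: add_nonneg_pos)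
    have t: "0 < t" "t \<le> 1" using \<open>\<epsilon> > 0\<close> pos by (auto simp: t_def)
    have "t * (norm (X *v u))\<^sup>2 \<le> t * ((norm (X *v u))\<^sup>2 + 1)"
      using t by (intro mult_left_mono) auto
    also have "\<dots> \<le> \<epsilon>"
      using pos by (simp add: t_def min_def pos_le_divide_eq)
    finally show "2 * ((X *v b - y) \<bullet> (X *v u)) \<le> ?e + \<epsilon>"
      using step[OF t] by linarith
  qed
  then show ?thesis by (simp add: u_def n_def)
qed

text \<open>Comparing the objective at \<open>b\<close> and \<open>\<beta>\<close> alone would not give the term \<open>(emp_norm (X *v (b - \<beta>)))\<^sup>2\<close> on the
left; it comes from the first order condition and is what later absorbs the noise.\<close>

lemma lasso_basic_inequality:
  fixes X :: "real ^ 'p ^ 'n"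
  assumes lasso: "is_lasso X lam (f + \<xi>) b" and "lam \<ge> 0"
  shows "(emp_norm (X *v b - f))\<^sup>2 + (emp_norm (X *v (b - \<beta>)))\<^sup>2
    \<le> (emp_norm (X *v \<beta> - f))\<^sup>2 + 2 * (\<xi> \<bullet> (X *v (b - \<beta>))) / real CARD('n)
      + 2 * lam * (lq_norm 1 \<beta> - lq_norm 1 b)"
proof -
  define n where "n = real CARD('n)"
  have "n > 0" by (simp add: n_def)
  define r w where "r = X *v b - f" and "w = X *v (b - \<beta>)"
  have "X *v \<beta> - f = r - w"
    by (simp add: r_def w_def matrix_vector_mult_diff_distrib)
  then have polar: "(norm r)\<^sup>2 + (norm w)\<^sup>2 = (norm (X *v \<beta> - f))\<^sup>2 + 2 * (r \<bullet> w)"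
    by (simp add: power2_norm_eq_inner inner_diff_left inner_diff_right inner_commute)
  have "(X *v b - (f + \<xi>)) \<bullet> w \<le> n * lam * (lq_norm 1 \<beta> - lq_norm 1 b)"
    using lasso_first_order[OF assms] by (simp add: w_def n_def)
  moreover have "(X *v b - (f + \<xi>)) \<bullet> w = r \<bullet> w - \<xi> \<bullet> w"
    by (simp add: r_def inner_diff_left inner_add_left)
  ultimately have "(norm r)\<^sup>2 + (norm w)\<^sup>2 \<le> (norm (X *v \<beta> - f))\<^sup>2 + 2 * (\<xi> \<bullet> w)
      + n * (2 * lam * (lq_norm 1 \<beta> - lq_norm 1 b))"
    using polar by simp
  then have "((norm r)\<^sup>2 + (norm w)\<^sup>2) / n \<le> ((norm (X *v \<beta> - f))\<^sup>2 + 2 * (\<xi> \<bullet> w)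
      + n * (2 * lam * (lq_norm 1 \<beta> - lq_norm 1 b))) / n"
    using \<open>n > 0\<close> by (intro divide_right_mono) auto
  then show ?thesis
    using \<open>n > 0\<close> unfolding emp_norm_square n_def[symmetric] r_def[symmetric] w_def[symmetric]
    by (simp add: add_divide_distrib)
qed

lemma l1_decrease_le_support:
  fixes b \<beta> :: "real ^ 'p"
  shows "lq_norm 1 \<beta> - lq_norm 1 b
    \<le> 2 * (\<Sum>j | \<beta> $ j \<noteq> 0. \<bar>(b - \<beta>) $ j\<bar>) - lq_norm 1 (b - \<beta>)"
proof -
  have "lq_norm 1 \<beta> - lq_norm 1 b + lq_norm 1 (b - \<beta>)
      = (\<Sum>j\<in>UNIV. \<bar>\<beta> $ j\<bar> - \<bar>b $ j\<bar> + \<bar>(b - \<beta>) $ j\<bar>)"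
    unfolding lq_norm_1 by (simp add: sum.distrib sum_subtractf)
  also have "\<dots> \<le> (\<Sum>j\<in>UNIV. if \<beta> $ j \<noteq> 0 then 2 * \<bar>(b - \<beta>) $ j\<bar> else 0)"
    by (intro sum_mono) auto
  also have "\<dots> = 2 * (\<Sum>j | \<beta> $ j \<noteq> 0. \<bar>(b - \<beta>) $ j\<bar>)"
    by (simp add: sum.If_cases sum_distrib_left)
  finally show ?thesis by simp
qed

lemma sum_abs_le_sqrt_card_norm:
  fixes u :: "real ^ 'p"
  shows "(\<Sum>j\<in>S. \<bar>u $ j\<bar>) \<le> sqrt (real (card S)) * norm u"
proof -
  have "(\<Sum>j\<in>S. \<bar>u $ j\<bar>)\<^sup>2 \<le> (\<Sum>j\<in>S. \<bar>u $ j\<bar>\<^sup>2) * (\<Sum>j\<in>S. 1\<^sup>2)"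
    using Cauchy_Schwarz_ineq_sum[of "\<lambda>j. \<bar>u $ j\<bar>" "\<lambda>_. 1" S] by simp
  also have "\<dots> = (\<Sum>j\<in>S. (u $ j)\<^sup>2) * real (card S)" by simp
  also have "\<dots> \<le> (norm u)\<^sup>2 * real (card S)"
    unfolding norm_vec_def L2_set_def
    by (intro mult_right_mono) (auto simp: sum_nonneg intro!: sum_mono2)
  also have "\<dots> = (sqrt (real (card S)) * norm u)\<^sup>2"
    by (simp add: power_mult_distrib)
  finally show ?thesis
    by (rule power2_le_imp_le) simp
qed

lemma SRE_theta_le:
  fixes X :: "real ^ 'p ^ 'n"
  assumes "s \<ge> 1" "c0 > 0" "\<delta> \<in> SRE_cone s c0"
  shows "SRE_theta X s c0 * norm \<delta> \<le> emp_norm (X *v \<delta>)"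
proof (cases "\<delta> = 0")
  case False
  with SRE_theta_attained[OF assms(1,2), of X] assms(3)
  have "SRE_theta X s c0 \<le> emp_norm (X *v \<delta>) / norm \<delta>" by (metis DiffI singletonD)
  with False show ?thesis by (simp add: pos_le_divide_eq)
qed (simp add: emp_norm_def)

text \<open>A basis vector lies in the cone, and the columns have norm at most one.\<close>

lemma SRE_theta_le_1:
  fixes X :: "real ^ 'p ^ 'n"
  assumes "s \<ge> 1" "c0 > 0" "SRE X s c0"
  shows "SRE_theta X s c0 \<le> 1"
proof -
  fix j :: 'p
  have "(\<Sum>i\<in>UNIV. \<bar>(axis j 1 :: real ^ 'p) $ i\<bar>) = 1"
    by (simp add: axis_def if_distrib[of abs] cong: if_cong)
  moreover have "1 * 1 \<le> (1 + c0) * sqrt (real s)"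
    using assms by (intro mult_mono) auto
  ultimately have "axis j 1 \<in> (SRE_cone s c0 :: (real ^ 'p) set)"
    by (simp add: SRE_cone_def lq_norm_1)
  then have "SRE_theta X s c0 * norm (axis j (1::real)) \<le> emp_norm (X *v axis j 1)"
    by (rule SRE_theta_le[OF assms(1,2)])
  also have "\<dots> \<le> 1" using assms(3) by (simp add: SRE_def)
  finally show ?thesis by simp
qed

text \<open>With \<open>u = b - \<beta>\<close>, \<open>P\<close> the \<open>\<ell>\<^sub>1\<close> mass of \<open>u\<close> on the support of \<open>\<beta>\<close> and \<open>N\<close> its full \<open>\<ell>\<^sub>1\<close> norm, the penalty terms
collect to \<open>lam * (4 * P - 123 / 100 * N)\<close>, where \<open>123 / 100 = 2 - 1 / 2 - 27 / 100\<close>. Outside the cone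
\<open>N > 8 * P\<close>, so this is negative. Inside it, \<open>P \<le> N\<close> and \<open>P \<le> sqrt s * norm u \<le> sqrt s * emp_norm (X *v u) / \<theta>\<close>.\<close>

lemma lasso_pathwise_bound:
  fixes X :: "real ^ 'p ^ 'n"
  assumes lasso: "is_lasso X lam (f + \<xi>) b" and "lam > 0" and "s \<ge> 1" and sre: "SRE X s 7"
    and sparse: "l0_norm \<beta> \<le> s"
    and noise: "2 * (\<xi> \<bullet> (X *v (b - \<beta>))) / real CARD('n)
      \<le> (emp_norm (X *v (b - \<beta>)))\<^sup>2 / 4 + lam\<^sup>2 * V / 20 + 27 / 100 * lam * lq_norm 1 (b - \<beta>)"
  shows "lam / 2 * lq_norm 1 (b - \<beta>) + (emp_norm (X *v b - f))\<^sup>2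
    \<le> (emp_norm (X *v \<beta> - f))\<^sup>2 + lam\<^sup>2 * (13 / 5 * real s / (SRE_theta X s 7)\<^sup>2 + V / 20)"
proof -
  define u where "u = b - \<beta>"
  define D where "D = emp_norm (X *v u)"
  define \<theta> where "\<theta> = SRE_theta X s 7"
  define N where "N = lq_norm 1 u"
  define P where "P = (\<Sum>j | \<beta> $ j \<noteq> 0. \<bar>u $ j\<bar>)"
  have "\<theta> > 0" using sre by (simp add: SRE_def \<theta>_def)
  have P: "P \<le> sqrt (real s) * norm u"
  proof -
    have "P \<le> sqrt (real (l0_norm \<beta>)) * norm u"
      unfolding P_def l0_norm_def by (rule sum_abs_le_sqrt_card_norm)
    also have "\<dots> \<le> sqrt (real s) * norm u"
      using sparse by (intro mult_right_mono) auto
    finally show ?thesis .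
  qed
  have "lam * (lq_norm 1 \<beta> - lq_norm 1 b) \<le> lam * (2 * P - N)"
    using l1_decrease_le_support[of \<beta> b] \<open>lam > 0\<close>
    by (intro mult_left_mono) (auto simp: P_def N_def u_def)
  then have core: "lam / 2 * N + (emp_norm (X *v b - f))\<^sup>2
      \<le> (emp_norm (X *v \<beta> - f))\<^sup>2 - 3 / 4 * D\<^sup>2 + lam\<^sup>2 * V / 20 + lam * (4 * P - 123 / 100 * N)"
    using lasso_basic_inequality[OF lasso, of \<beta>] noise \<open>lam > 0\<close>
    unfolding u_def[symmetric] D_def[symmetric] N_def[symmetric] by (simp add: algebra_simps)
  have "lam * (4 * P - 123 / 100 * N) \<le> 3 / 4 * D\<^sup>2 + lam\<^sup>2 * (13 / 5 * real s / \<theta>\<^sup>2)"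
  proof (cases "u \<in> SRE_cone s 7")
    case True
    have "P \<le> N"
      unfolding P_def N_def lq_norm_1 by (intro sum_mono2) auto
    define a where "a = lam * sqrt (real s) / \<theta>"
    have "norm u \<le> D / \<theta>"
      using SRE_theta_le[OF \<open>s \<ge> 1\<close> _ True, of X] \<open>\<theta> > 0\<close>
      by (simp add: D_def \<theta>_def pos_le_divide_eq mult.commute)
    then have "P \<le> sqrt (real s) * (D / \<theta>)"
      using P by (meson mult_left_mono order_trans real_sqrt_ge_zero of_nat_0_le_iff)
    then have "lam * P \<le> a * D"
      using \<open>lam > 0\<close> mult_left_mono[of P "sqrt (real s) * (D / \<theta>)" lam] by (simp add: a_def mult_ac)
    moreover have "lam * (4 * P - 123 / 100 * N) \<le> 277 / 100 * (lam * P)"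
      using \<open>P \<le> N\<close> \<open>lam > 0\<close> mult_left_mono[of P N lam] by (simp add: algebra_simps)
    moreover have "277 / 100 * (a * D) \<le> 3 / 4 * D\<^sup>2 + 13 / 5 * a\<^sup>2"
    proof -
      \<comment> \<open>Completing the square leaves \<open>277\<^sup>2 / 30000 < 13 / 5\<close> as the coefficient of \<open>a\<^sup>2\<close>.\<close>
      have "0 \<le> 3 / 4 * (D - 277 / 150 * a)\<^sup>2 + (13 / 5 - 3 / 4 * (277 / 150)\<^sup>2) * a\<^sup>2"
        by (intro add_nonneg_nonneg mult_nonneg_nonneg) (auto simp: power2_eq_square)
      then show ?thesis by (simp add: power2_eq_square algebra_simps)
    qed
    moreover have "lam\<^sup>2 * (13 / 5 * real s / \<theta>\<^sup>2) = 13 / 5 * a\<^sup>2"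
      by (simp add: a_def power_divide power_mult_distrib)
    ultimately show ?thesis by linarith
  next
    case False
    then have "8 * (sqrt (real s) * norm u) < N"
      by (simp add: SRE_cone_def N_def)
    moreover have "0 \<le> sqrt (real s) * norm u" by simp
    ultimately have "4 * P - 123 / 100 * N \<le> 0" using P by linarith
    then have "lam * (4 * P - 123 / 100 * N) \<le> 0"
      using \<open>lam > 0\<close> by (simp add: mult_le_0_iff)
    also have "0 \<le> 3 / 4 * D\<^sup>2 + lam\<^sup>2 * (13 / 5 * real s / \<theta>\<^sup>2)" by simp
    finally show ?thesis .
  qed
  with core show ?thesis
    unfolding u_def[symmetric] N_def[symmetric] \<theta>_def[symmetric] by (simp add: algebra_simps)
qed

text \<open>For \<open>y \<ge> 0\<close> and \<open>1 \<le> q \<le> 2\<close>, \<open>y powr q\<close> is at most \<open>y\<close> or \<open>y\<^sup>2\<close>. Applied to \<open>y = \<bar>u $ j\<bar> / r\<close> this is an additive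
form of interpolation between the \<open>\<ell>\<^sub>1\<close> and \<open>\<ell>\<^sub>2\<close> norms; its right-hand side is
linear in the two quantities whose expectations are known.\<close>

lemma sum_powr_le_l1_l2:
  fixes u :: "real ^ 'p"
  assumes q: "1 \<le> q" "q \<le> 2" and "r > 0"
  shows "lq_norm q u powr q \<le> r powr q * ((norm u)\<^sup>2 / r\<^sup>2 + lq_norm 1 u / r)"
proof -
  have coord: "\<bar>t\<bar> powr q \<le> r powr q * (t\<^sup>2 / r\<^sup>2 + \<bar>t\<bar> / r)" for t
  proof -
    define y where "y = \<bar>t\<bar> / r"
    have "y \<ge> 0" using \<open>r > 0\<close> by (simp add: y_def)
    have "y powr q \<le> y\<^sup>2 + y"
    proof (cases "y \<le> 1")
      case True
      then have "y powr q \<le> y powr 1" using \<open>y \<ge> 0\<close> q by (intro powr_mono') auto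
      then show ?thesis using \<open>y \<ge> 0\<close> by (simp add: add_increasing)
    next
      case False
      then have "y powr q \<le> y powr 2" using q by (intro powr_mono) auto
      then show ?thesis using False by (simp add: powr_numeral)
    qed
    then have "r powr q * y powr q \<le> r powr q * (y\<^sup>2 + y)"
      by (intro mult_left_mono) auto
    moreover have "\<bar>t\<bar> powr q = r powr q * y powr q"
      using \<open>r > 0\<close> \<open>y \<ge> 0\<close> by (simp add: y_def powr_divide)
    ultimately show ?thesis by (simp add: y_def power_divide)
  qed
  have "lq_norm q u powr q = (\<Sum>j\<in>UNIV. \<bar>u $ j\<bar> powr q)"
    using q by (simp add: lq_norm_def powr_powr sum_nonneg)
  also have "\<dots> \<le> (\<Sum>j\<in>UNIV. r powr q * ((u $ j)\<^sup>2 / r\<^sup>2 + \<bar>u $ j\<bar> / r))"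
    by (intro sum_mono coord)
  also have "\<dots> = r powr q * ((norm u)\<^sup>2 / r\<^sup>2 + lq_norm 1 u / r)"
    by (simp add: lq_norm_1 norm_vec_def L2_set_def sum_nonneg sum_divide_distrib
        flip: sum_distrib_left sum.distrib)
  finally show ?thesis .
qed

text \<open>On the cone the prediction error controls the Euclidean norm, off the cone the \<open>\<ell>\<^sub>1\<close> norm does. The two
cases give the two summands.\<close>

lemma l2_le_of_prediction_and_l1:
  fixes X :: "real ^ 'p ^ 'n"
  assumes "lam > 0" "s \<ge> 1" and sre: "SRE X s 7" and "B \<ge> 0"
    and bound: "lam / 2 * lq_norm 1 u + (emp_norm (X *v u))\<^sup>2 \<le> lam\<^sup>2 * B"
  shows "(norm u)\<^sup>2 \<le> lam\<^sup>2 * (B / (SRE_theta X s 7)\<^sup>2 + B\<^sup>2 / (16 * real s))"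
proof (cases "u \<in> SRE_cone s 7")
  case True
  define \<theta> where "\<theta> = SRE_theta X s 7"
  have "\<theta> > 0" using sre by (simp add: SRE_def \<theta>_def)
  have "(\<theta> * norm u)\<^sup>2 \<le> (emp_norm (X *v u))\<^sup>2"
    using SRE_theta_le[OF \<open>s \<ge> 1\<close> _ True, of X] \<open>\<theta> > 0\<close> by (intro power_mono) (auto simp: \<theta>_def)
  also have "\<dots> \<le> lam\<^sup>2 * B"
    using bound \<open>lam > 0\<close> by (smt (verit) mult_nonneg_nonneg lq_norm_1 sum_nonneg abs_ge_zero divide_nonneg_nonneg)
  finally have "(norm u)\<^sup>2 \<le> lam\<^sup>2 * B / \<theta>\<^sup>2"
    using \<open>\<theta> > 0\<close> by (simp add: power_mult_distrib pos_le_divide_eq mult.commute)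
  also have "\<dots> \<le> lam\<^sup>2 * (B / \<theta>\<^sup>2 + B\<^sup>2 / (16 * real s))"
    by (simp add: distrib_left)
  finally show ?thesis unfolding \<theta>_def .
next
  case False
  have "sqrt (real s) > 0" using \<open>s \<ge> 1\<close> by simp
  from False have "8 * (sqrt (real s) * norm u) \<le> lq_norm 1 u"
    by (simp add: SRE_cone_def)
  then have "lam / 2 * (8 * (sqrt (real s) * norm u)) \<le> lam / 2 * lq_norm 1 u"
    using \<open>lam > 0\<close> by (intro mult_left_mono) auto
  also have "\<dots> \<le> lam\<^sup>2 * B" using bound zero_le_power2[of "emp_norm (X *v u)"] by linarith
  finally have "lam * (4 * sqrt (real s) * norm u) \<le> lam * (lam * B)"
    by (simp add: power2_eq_square mult_ac)
  then have "4 * sqrt (real s) * norm u \<le> lam * B"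
    using \<open>lam > 0\<close> by simp
  then have "(4 * sqrt (real s) * norm u)\<^sup>2 \<le> (lam * B)\<^sup>2"
    by (intro power_mono) auto
  then have "(norm u)\<^sup>2 \<le> lam\<^sup>2 * (B\<^sup>2 / (16 * real s))"
    using \<open>s \<ge> 1\<close> by (simp add: power_mult_distrib field_simps)
  also have "\<dots> \<le> lam\<^sup>2 * (B / (SRE_theta X s 7)\<^sup>2 + B\<^sup>2 / (16 * real s))"
    using \<open>B \<ge> 0\<close> by (intro mult_left_mono) auto
  finally show ?thesis .
qed

section \<open>Bounds in expectation\<close>

text \<open>Both moments follow by comparing \<open>V\<close> and \<open>V\<^sup>2\<close> pointwise with constants plus multiples of \<open>exp (V - m)\<close>, whose
expectation is at most one.\<close>

lemma (in prob_space) moments_of_exp_moment: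
  fixes V :: "'a \<Rightarrow> real"
  assumes meas [measurable]: "V \<in> borel_measurable M" and nonneg: "\<And>\<omega>. V \<omega> \<ge> 0"
    and exp_moment: "(\<integral>\<^sup>+\<omega>. ennreal (exp (V \<omega>)) \<partial>M) \<le> ennreal (exp m)" and "m \<ge> 1"
  shows "integrable M V" "expectation V \<le> m"
    "integrable M (\<lambda>\<omega>. (V \<omega>)\<^sup>2)" "expectation (\<lambda>\<omega>. (V \<omega>)\<^sup>2) \<le> 6 * m\<^sup>2"
proof -
  have int: "integrable M (\<lambda>\<omega>. exp (V \<omega>))"
    using exp_moment by (intro integrableI_nonneg) (auto simp: less_top[symmetric] top_unique)
  then have "ennreal (expectation (\<lambda>\<omega>. exp (V \<omega>))) \<le> ennreal (exp m)"
    using exp_moment by (subst nn_integral_eq_integral[symmetric]) auto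
  then have E: "expectation (\<lambda>\<omega>. exp (V \<omega> - m)) \<le> 1"
    using int by (simp add: exp_diff)
  have int': "integrable M (\<lambda>\<omega>. exp (V \<omega> - m))"
    using int by (simp add: exp_diff)
  have le1: "V \<omega> \<le> m - 1 + exp (V \<omega> - m)" for \<omega>
    using exp_ge_add_one_self[of "V \<omega> - m"] by linarith
  have le2: "(V \<omega>)\<^sup>2 \<le> 2 * m\<^sup>2 + 4 * exp (V \<omega> - m)" for \<omega>
  proof (cases "V \<omega> \<le> m")
    case True
    then have "(V \<omega>)\<^sup>2 \<le> m\<^sup>2" using nonneg by (intro power_mono) auto
    moreover have "0 \<le> m\<^sup>2" by simp
    ultimately show ?thesis using exp_ge_zero[of "V \<omega> - m"] by linarith
  next
    case False
    then have "1 + (V \<omega> - m) + (V \<omega> - m)\<^sup>2 / 2 \<le> exp (V \<omega> - m)"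
      by (intro exp_lower_Taylor_quadratic) auto
    moreover have "(V \<omega>)\<^sup>2 \<le> 2 * m\<^sup>2 + 2 * (V \<omega> - m)\<^sup>2"
      using zero_le_power2[of "m - (V \<omega> - m)"] by (simp add: power2_eq_square algebra_simps)
    ultimately show ?thesis using False by linarith
  qed
  show 1: "integrable M V"
    by (rule Bochner_Integration.integrable_bound[where f = "\<lambda>\<omega>. m - 1 + exp (V \<omega> - m)"])
      (use int' le1 nonneg in \<open>auto simp: abs_le_iff intro!: AE_I2 order_trans[OF _ abs_ge_self]\<close>)
  show 2: "integrable M (\<lambda>\<omega>. (V \<omega>)\<^sup>2)"
    by (rule Bochner_Integration.integrable_bound[where f = "\<lambda>\<omega>. 2 * m\<^sup>2 + 4 * exp (V \<omega> - m)"])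
      (use int' le2 in \<open>auto intro!: AE_I2 order_trans[OF _ abs_ge_self]\<close>)
  have "expectation V \<le> expectation (\<lambda>\<omega>. m - 1 + exp (V \<omega> - m))"
    using 1 int' le1 by (intro integral_mono) auto
  also have "\<dots> \<le> m" using int' E by (simp add: prob_space)
  finally show "expectation V \<le> m" .
  have "expectation (\<lambda>\<omega>. (V \<omega>)\<^sup>2) \<le> expectation (\<lambda>\<omega>. 2 * m\<^sup>2 + 4 * exp (V \<omega> - m))"
    using 2 int' le2 by (intro integral_mono) auto
  also have "\<dots> \<le> 2 * m\<^sup>2 + 4" using int' E by (simp add: prob_space)
  also have "\<dots> \<le> 6 * m\<^sup>2" using \<open>m \<ge> 1\<close> power_mono[of 1 m 2] by simp
  finally show "expectation (\<lambda>\<omega>. (V \<omega>)\<^sup>2) \<le> 6 * m\<^sup>2" .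
qed

lemma (in prob_space) integrable_expectation_le_AE:
  fixes f g :: "'a \<Rightarrow> real"
  assumes "f \<in> borel_measurable M" "\<And>\<omega>. f \<omega> \<ge> 0" "AE \<omega> in M. f \<omega> \<le> g \<omega>"
    "integrable M g" "expectation g \<le> K"
  shows "integrable M f \<and> expectation f \<le> K"
proof -
  have "integrable M f"
    by (rule Bochner_Integration.integrable_bound[OF assms(4,1)])
      (use assms(2,3) in \<open>auto elim!: eventually_mono\<close>)
  then show ?thesis
    using integral_mono_AE[OF _ assms(4,3)] assms(5) by auto
qed

lemma measurable_vec_nth [measurable (raw)]:
  fixes f :: "'a \<Rightarrow> real ^ 'p"
  assumes "f \<in> borel_measurable M"
  shows "(\<lambda>\<omega>. f \<omega> $ j) \<in> borel_measurable M"
  by (rule measurable_compose[OF assms]) (intro borel_measurable_continuous_onI continuous_intros)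

lemma measurable_emp_norm_affine:
  fixes X :: "real ^ 'p ^ 'n" and g :: "'a \<Rightarrow> real ^ 'p"
  assumes "g \<in> borel_measurable M"
  shows "(\<lambda>\<omega>. emp_norm (X *v g \<omega> - f)) \<in> borel_measurable M"
  unfolding emp_norm_eq
  by (rule measurable_compose[OF assms])
    (intro borel_measurable_continuous_onI continuous_intros linear_continuous_on
      linear_linear[THEN iffD2, OF matrix_vector_mul_linear], auto)

lemma sqrt2_bounds: "7 / 5 \<le> sqrt 2" "sqrt 2 \<le> 142 / 100"
  by (rule real_le_rsqrt real_le_lsqrt; simp add: power2_eq_square)+

text \<open>The two consequences of the choice of \<open>lam\<close>: it dominates the \<open>\<ell>\<^sub>1\<close> part of the noise bound, since
\<open>sqrt 2 \<le> 27 / 100 * (4 + sqrt 2)\<close>, and it dominates the noise level, since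
\<open>4 * (4 + sqrt 2)\<^sup>2 * L \<ge> 160\<close>.\<close>

lemma lasso_tuning:
  fixes \<sigma> lam L n :: real
  assumes "\<sigma> > 0" "n > 0" "L \<ge> 3 / 2" and lam: "lam \<ge> 2 * (4 + sqrt 2) * \<sigma> * sqrt (L / n)"
  shows "lam > 0" "2 * (\<sigma> * sqrt (2 * n * L)) / n \<le> 27 / 100 * lam" "8 * \<sigma>\<^sup>2 / n \<le> lam\<^sup>2 / 20"
proof -
  define w where "w = \<sigma> * sqrt (L / n)"
  have "w > 0" using assms by (simp add: w_def)
  have lam': "lam \<ge> 2 * (4 + sqrt 2) * w" using lam by (simp add: w_def mult_ac)
  have "0 < 2 * (4 + sqrt 2) * w" using \<open>w > 0\<close> sqrt2_bounds by simp
  then show "lam > 0" using lam' by linarith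
  have "sqrt (2 * n * L) / n = sqrt 2 * sqrt (L / n)"
    using assms by (simp add: real_sqrt_mult real_sqrt_divide real_div_sqrt field_simps)
  moreover have "2 * (\<sigma> * sqrt (2 * n * L)) / n = 2 * \<sigma> * (sqrt (2 * n * L) / n)" by simp
  ultimately have "2 * (\<sigma> * sqrt (2 * n * L)) / n = 2 * sqrt 2 * w"
    by (simp only: w_def mult_ac)
  also have "\<dots> \<le> 27 / 100 * (2 * (4 + sqrt 2)) * w"
    using \<open>w > 0\<close> sqrt2_bounds by (intro mult_right_mono) auto
  also have "\<dots> \<le> 27 / 100 * lam"
    using mult_left_mono[OF lam', of "27 / 100"] by (simp add: algebra_simps)
  finally show "2 * (\<sigma> * sqrt (2 * n * L)) / n \<le> 27 / 100 * lam" .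
  have "(54 / 5) * w \<le> 2 * (4 + sqrt 2) * w"
    using \<open>w > 0\<close> sqrt2_bounds by (intro mult_right_mono) auto
  then have "(54 / 5) * w \<le> lam" using lam' by linarith
  then have "((54 / 5) * w)\<^sup>2 \<le> lam\<^sup>2"
    using \<open>w > 0\<close> by (intro power_mono) auto
  then have w2: "2916 / 25 * w\<^sup>2 \<le> lam\<^sup>2"
    by (simp add: power_mult_distrib power_divide)
  define y where "y = \<sigma>\<^sup>2 / n"
  have "y \<ge> 0" using assms by (simp add: y_def)
  have "w\<^sup>2 = y * L"
    using assms by (simp add: w_def y_def power_mult_distrib)
  moreover have "y * (3 / 2) \<le> y * L"
    using assms \<open>y \<ge> 0\<close> by (intro mult_left_mono) auto
  ultimately have "8 * y \<le> lam\<^sup>2 / 20" using w2 \<open>y \<ge> 0\<close> by linarith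
  then show "8 * \<sigma>\<^sup>2 / n \<le> lam\<^sup>2 / 20" by (simp add: y_def)
qed

text \<open>With the geometric ratio \<open>x = s / (2 e p)\<close>, for which \<open>ln (1 / x)\<close> is the logarithm in the tuning parameter,
the factor \<open>1 + O(x)\<close> of each of the \<open>p\<close> coordinates contributes \<open>O(s)\<close> to the exponent.\<close>

lemma lattice_normaliser_le:
  fixes s p :: nat
  assumes "1 \<le> s" "s \<le> p"
  defines "x \<equiv> real s / (2 * exp 1 * real p)"
  shows "0 < x" "x < 1" "((1 + x) / (1 - x)) ^ p \<le> exp (real s)"
proof -
  have e: "exp 1 \<ge> (2 :: real)" using exp_ge_add_one_self[of 1] by simp
  have "real s \<le> real p" "real p > 0" using assms by auto
  then show "0 < x" using assms by (simp add: x_def)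
  have "2 * exp 1 * real p \<ge> 4 * real p"
    using e \<open>real p > 0\<close> by (intro mult_right_mono) auto
  then have "x \<le> real s / (4 * real p)"
    unfolding x_def using \<open>real p > 0\<close> by (intro divide_left_mono) auto
  also have "\<dots> \<le> 1 / 4" using \<open>real s \<le> real p\<close> \<open>real p > 0\<close> by (simp add: field_simps)
  finally have "x \<le> 1 / 4" .
  then show "x < 1" by simp
  have "(1 + x) / (1 - x) = 1 + 2 * x / (1 - x)" using \<open>x < 1\<close> by (simp add: field_simps)
  also have "\<dots> \<le> 1 + 2 * x / (1 / 2)"
    using \<open>0 < x\<close> \<open>x \<le> 1 / 4\<close> by (intro add_left_mono divide_left_mono) auto
  also have "\<dots> \<le> exp (4 * x)" using exp_ge_add_one_self[of "4 * x"] by simp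
  finally have "((1 + x) / (1 - x)) ^ p \<le> exp (4 * x) ^ p"
    using \<open>0 < x\<close> \<open>x < 1\<close> by (intro power_mono) auto
  also have "\<dots> = exp (real p * (4 * x))" by (simp add: exp_of_nat_mult)
  also have "real p * (4 * x) = real s * (2 / exp 1)"
    using \<open>real p > 0\<close> by (simp add: x_def field_simps)
  also have "exp \<dots> \<le> exp (real s)"
    using mult_left_mono[OF e, of "real s"] by (simp add: field_simps)
  finally show "((1 + x) / (1 - x)) ^ p \<le> exp (real s)" by simp
qed

theorem corollary4p4:
  fixes X :: "real ^ 'p ^ 'n" and f :: "real ^ 'n" and \<sigma> lam :: real and s :: nat
    and M :: "'w measure" and \<xi> :: "'w \<Rightarrow> real ^ 'n" and \<beta>hat :: "'w \<Rightarrow> real ^ 'p"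
  assumes "prob_space M"
    and "\<sigma> > 0"
    and "gaussian_noise M \<sigma> \<xi>"
    and "s \<in> {1..CARD('p)}"
    and "SRE X s 7"
    and "lam \<ge> 2 * (4 + sqrt 2) * \<sigma> * sqrt (ln (2 * exp 1 * real CARD('p) / real s) / real CARD('n))"
    and "\<beta>hat \<in> borel_measurable M"
    and "\<And>\<omega>. \<omega> \<in> space M \<Longrightarrow> is_lasso X lam (f + \<xi> \<omega>) (\<beta>hat \<omega>)"
  shows "(\<forall>\<beta>. l0_norm \<beta> \<le> s \<longrightarrow>
            integrable M (\<lambda>\<omega>. lam / 2 * lq_norm 1 (\<beta>hat \<omega> - \<beta>) + (emp_norm (X *v \<beta>hat \<omega> - f))\<^sup>2) \<and>
            (\<integral>\<omega>. lam / 2 * lq_norm 1 (\<beta>hat \<omega> - \<beta>) + (emp_norm (X *v \<beta>hat \<omega> - f))\<^sup>2 \<partial>M)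
              \<le> (emp_norm (X *v \<beta> - f))\<^sup>2 + 49 * lam\<^sup>2 * real s / 16 *
                  (1 / (SRE_theta X s 7)\<^sup>2 + 1 / (2 * ln (2 * exp 1 * real CARD('p)))))
       \<and> (\<forall>\<beta>star q. f = X *v \<beta>star \<longrightarrow> l0_norm \<beta>star \<le> s \<longrightarrow> 1 \<le> q \<longrightarrow> q \<le> 2 \<longrightarrow>
            integrable M (\<lambda>\<omega>. lq_norm q (\<beta>star - \<beta>hat \<omega>) powr q) \<and>
            (\<integral>\<omega>. lq_norm q (\<beta>star - \<beta>hat \<omega>) powr q \<partial>M)
              \<le> 49 powr q * lam powr q * real s / 8 powr q *
                  (1 / SRE_theta X s 7 powr (2 * q) + 1 / ln (2 * exp 1 * real CARD('p)) powr q))"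
proof -
  interpret prob_space M by fact
  note lasso = assms(8)
  have [measurable]: "\<beta>hat \<in> borel_measurable M" by fact
  define n where "n = real CARD('n)"
  define p where "p = CARD('p)"
  define \<theta> where "\<theta> = SRE_theta X s 7"
  define x where "x = real s / (2 * exp 1 * real p)"
  define L where "L = ln (1 / x)"
  have "n > 0" by (simp add: n_def)
  have s: "1 \<le> s" "s \<le> p" using assms(4) by (auto simp: p_def)
  then have "real s \<ge> 1" "real s \<le> real p" "real p > 0" by auto
  have \<theta>: "0 < \<theta>" "\<theta> \<le> 1"
    using assms(5) SRE_theta_le_1[OF s(1) _ assms(5)] by (auto simp: SRE_def \<theta>_def)
  have x: "0 < x" "x < 1" "((1 + x) / (1 - x)) ^ p \<le> exp (real s)"
    using lattice_normaliser_le[OF s] unfolding x_def by blast+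
  have ln2e: "ln (2 * exp 1 :: real) \<ge> 3 / 2"
    using ln2_ge_two_thirds by (simp add: ln_mult)
  have L_eq: "L = ln (2 * exp 1 * real p / real s)"
    by (simp add: L_def x_def)
  have "L \<ge> 3 / 2"
  proof -
    have "ln (2 * exp 1) \<le> L"
      unfolding L_eq using \<open>real s \<ge> 1\<close> \<open>real s \<le> real p\<close> by (intro ln_mono) (auto simp: field_simps)
    then show ?thesis using ln2e by linarith
  qed
  have log_pos: "0 < ln (2 * exp 1 * real p)"
  proof -
    have "ln (2 * exp 1 * real p) = ln (2 * exp 1) + ln (real p)"
      using \<open>real p > 0\<close> by (intro ln_mult_pos) auto
    moreover have "ln (real p) \<ge> 0" using \<open>real s \<ge> 1\<close> \<open>real s \<le> real p\<close> by simp
    ultimately show ?thesis using ln2e by linarith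
  qed
  have tuning: "lam > 0" "2 * (\<sigma> * sqrt (2 * n * L)) / n \<le> 27 / 100 * lam" "8 * \<sigma>\<^sup>2 / n \<le> lam\<^sup>2 / 20"
    using lasso_tuning[OF assms(2) \<open>n > 0\<close> \<open>L \<ge> 3 / 2\<close>] assms(6)
    unfolding L_eq n_def p_def by auto
  have col: "(norm (X *v axis j 1))\<^sup>2 \<le> n" for j
  proof -
    have "(emp_norm (X *v axis j 1))\<^sup>2 \<le> 1\<^sup>2"
      using assms(5) by (intro power_mono) (auto simp: SRE_def emp_norm_eq)
    then show ?thesis by (simp add: emp_norm_square n_def)
  qed
  obtain V where V: "V \<in> borel_measurable M" "\<And>\<omega>. V \<omega> \<ge> 0"
    "(\<integral>\<^sup>+\<omega>. ennreal (exp (V \<omega>)) \<partial>M) \<le> ennreal (((1 + x) / (1 - x)) ^ CARD('p))"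
    "AE \<omega> in M. \<forall>u c. c > 0 \<longrightarrow> \<xi> \<omega> \<bullet> (X *v u) \<le> V \<omega> / c
        + c * \<sigma>\<^sup>2 * (norm (X *v u))\<^sup>2 / 2 + \<sigma> * sqrt (2 * n * ln (1 / x)) * (\<Sum>i\<in>UNIV. \<bar>u $ i\<bar>)"
    using gaussian_uniform_bound[OF assms(2,3) col \<open>n > 0\<close> x(1,2)] by blast
  have "(\<integral>\<^sup>+\<omega>. ennreal (exp (V \<omega>)) \<partial>M) \<le> ennreal (exp (real s))"
    using V(3) x(3) unfolding p_def by (meson ennreal_leI order_trans)
  note moments = moments_of_exp_moment[OF V(1,2) this \<open>real s \<ge> 1\<close>]

  \<comment> \<open>The excess in \<open>lasso_pathwise_bound\<close>, in units of \<open>lam\<^sup>2\<close>.\<close>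
  define B where "B \<omega> = 13 / 5 * real s / \<theta>\<^sup>2 + V \<omega> / 20" for \<omega>
  have B_nonneg: "B \<omega> \<ge> 0" for \<omega> using V(2) by (simp add: B_def)
  have s_le: "real s \<le> real s / \<theta>\<^sup>2"
    using \<theta> \<open>real s \<ge> 1\<close> power_le_one[of \<theta> 2] by (simp add: pos_le_divide_eq mult_left_le)
  have B_int [simp]: "integrable M B" unfolding B_def using moments(1) by simp
  have B_exp: "expectation B \<le> 53 / 20 * real s / \<theta>\<^sup>2"
  proof -
    have "expectation B = 13 / 5 * (real s / \<theta>\<^sup>2) + expectation V / 20"
      unfolding B_def using moments(1) by (simp add: prob_space)
    then show ?thesis using moments(2) s_le by simp
  qed
  have B2_le: "(B \<omega>)\<^sup>2 \<le> 2 * (13 / 5 * real s / \<theta>\<^sup>2)\<^sup>2 + (V \<omega>)\<^sup>2 / 200" for \<omega>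
    using zero_le_power2[of "13 / 5 * real s / \<theta>\<^sup>2 - V \<omega> / 20"]
    unfolding B_def by (simp add: power2_sum power2_diff power_divide)
  have B2_int [simp]: "integrable M (\<lambda>\<omega>. (B \<omega>)\<^sup>2)"
    by (rule Bochner_Integration.integrable_bound
        [where f = "\<lambda>\<omega>. 2 * (13 / 5 * real s / \<theta>\<^sup>2)\<^sup>2 + (V \<omega>)\<^sup>2 / 200"])
      (use moments(3) B2_le V(1) in \<open>auto simp: B_def intro!: AE_I2 order_trans[OF _ abs_ge_self]\<close>)
  have B2_exp: "expectation (\<lambda>\<omega>. (B \<omega>)\<^sup>2) \<le> 14 * (real s / \<theta>\<^sup>2)\<^sup>2"
  proof -
    have "expectation (\<lambda>\<omega>. (B \<omega>)\<^sup>2) \<le> expectation (\<lambda>\<omega>. 2 * (13 / 5 * real s / \<theta>\<^sup>2)\<^sup>2 + (V \<omega>)\<^sup>2 / 200)"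
      using moments(3) B2_le by (intro integral_mono) auto
    also have "\<dots> = 2 * (13 / 5 * real s / \<theta>\<^sup>2)\<^sup>2 + expectation (\<lambda>\<omega>. (V \<omega>)\<^sup>2) / 200"
      using moments(3) by (simp add: prob_space)
    also have "2 * (13 / 5 * real s / \<theta>\<^sup>2)\<^sup>2 = 338 / 25 * (real s / \<theta>\<^sup>2)\<^sup>2"
      by (simp add: power_mult_distrib power_divide)
    also have "338 / 25 * (real s / \<theta>\<^sup>2)\<^sup>2 + expectation (\<lambda>\<omega>. (V \<omega>)\<^sup>2) / 200 \<le> 14 * (real s / \<theta>\<^sup>2)\<^sup>2"
    proof -
      have "(real s)\<^sup>2 \<le> (real s / \<theta>\<^sup>2)\<^sup>2" using s_le by (intro power_mono) auto
      then show ?thesis using moments(4) zero_le_power2[of "real s / \<theta>\<^sup>2"] by linarith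
    qed
    finally show ?thesis .
  qed

  have pathwise: "AE \<omega> in M. lam / 2 * lq_norm 1 (\<beta>hat \<omega> - \<beta>) + (emp_norm (X *v \<beta>hat \<omega> - f))\<^sup>2
      \<le> (emp_norm (X *v \<beta> - f))\<^sup>2 + lam\<^sup>2 * B \<omega>" if sparse: "l0_norm \<beta> \<le> s" for \<beta>
    using V(4) AE_space
  proof eventually_elim
    case (elim \<omega>)
    define u where "u = \<beta>hat \<omega> - \<beta>"
    \<comment> \<open>The choice \<open>c = 1 / (4 * \<sigma>\<^sup>2)\<close> spends a quarter of the spare prediction error on the noise.\<close>
    have "\<xi> \<omega> \<bullet> (X *v u) \<le> V \<omega> * (4 * \<sigma>\<^sup>2) + (norm (X *v u))\<^sup>2 / 8
        + \<sigma> * sqrt (2 * n * L) * lq_norm 1 u"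
      using elim(1)[rule_format, of "1 / (4 * \<sigma>\<^sup>2)" u] assms(2) by (simp add: L_def lq_norm_1)
    then have "2 * (\<xi> \<omega> \<bullet> (X *v u)) / n \<le> 2 * (V \<omega> * (4 * \<sigma>\<^sup>2) + (norm (X *v u))\<^sup>2 / 8
        + \<sigma> * sqrt (2 * n * L) * lq_norm 1 u) / n"
      using \<open>n > 0\<close> by (intro divide_right_mono mult_left_mono) auto
    also have "\<dots> = (emp_norm (X *v u))\<^sup>2 / 4 + (8 * \<sigma>\<^sup>2 / n) * V \<omega>
        + (2 * (\<sigma> * sqrt (2 * n * L)) / n) * lq_norm 1 u"
      using \<open>n > 0\<close> by (simp add: emp_norm_square n_def[symmetric] field_simps)
    also have "\<dots> \<le> (emp_norm (X *v u))\<^sup>2 / 4 + (lam\<^sup>2 / 20) * V \<omega> + (27 / 100 * lam) * lq_norm 1 u"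
      using tuning V(2) by (intro add_mono mult_right_mono) (auto simp: lq_norm_1 sum_nonneg)
    finally have "2 * (\<xi> \<omega> \<bullet> (X *v u)) / n
        \<le> (emp_norm (X *v u))\<^sup>2 / 4 + lam\<^sup>2 * V \<omega> / 20 + 27 / 100 * lam * lq_norm 1 u" by simp
    then show ?case
      using lasso_pathwise_bound[OF lasso[OF elim(2)] tuning(1) s(1) assms(5) sparse]
      unfolding u_def n_def B_def \<theta>_def by blast
  qed

  have part1: "integrable M (\<lambda>\<omega>. lam / 2 * lq_norm 1 (\<beta>hat \<omega> - \<beta>) + (emp_norm (X *v \<beta>hat \<omega> - f))\<^sup>2) \<and>
      (\<integral>\<omega>. lam / 2 * lq_norm 1 (\<beta>hat \<omega> - \<beta>) + (emp_norm (X *v \<beta>hat \<omega> - f))\<^sup>2 \<partial>M)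
        \<le> (emp_norm (X *v \<beta> - f))\<^sup>2 + 49 * lam\<^sup>2 * real s / 16 *
            (1 / \<theta>\<^sup>2 + 1 / (2 * ln (2 * exp 1 * real p)))" if sparse: "l0_norm \<beta> \<le> s" for \<beta>
  proof (rule integrable_expectation_le_AE[OF _ _ pathwise[OF sparse]])
    show "(\<lambda>\<omega>. lam / 2 * lq_norm 1 (\<beta>hat \<omega> - \<beta>) + (emp_norm (X *v \<beta>hat \<omega> - f))\<^sup>2) \<in> borel_measurable M"
      using measurable_emp_norm_affine[OF assms(7), of X f] unfolding lq_norm_1 by measurable
    show "lam / 2 * lq_norm 1 (\<beta>hat \<omega> - \<beta>) + (emp_norm (X *v \<beta>hat \<omega> - f))\<^sup>2 \<ge> 0" for \<omega>
      using tuning(1) by (simp add: lq_norm_1 sum_nonneg)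
    show "integrable M (\<lambda>\<omega>. (emp_norm (X *v \<beta> - f))\<^sup>2 + lam\<^sup>2 * B \<omega>)" by simp
    have "lam\<^sup>2 * expectation B \<le> lam\<^sup>2 * (53 / 20 * real s / \<theta>\<^sup>2)"
      using B_exp by (intro mult_left_mono) auto
    also have "\<dots> \<le> lam\<^sup>2 * (49 / 16 * real s / \<theta>\<^sup>2)"
      by (intro mult_left_mono divide_right_mono) auto
    also have "\<dots> = 49 * lam\<^sup>2 * real s / 16 * (1 / \<theta>\<^sup>2)" by simp
    also have "\<dots> \<le> 49 * lam\<^sup>2 * real s / 16 * (1 / \<theta>\<^sup>2 + 1 / (2 * ln (2 * exp 1 * real p)))"
      using log_pos by (intro mult_left_mono) auto
    finally show "expectation (\<lambda>\<omega>. (emp_norm (X *v \<beta> - f))\<^sup>2 + lam\<^sup>2 * B \<omega>)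
        \<le> (emp_norm (X *v \<beta> - f))\<^sup>2 + 49 * lam\<^sup>2 * real s / 16 *
            (1 / \<theta>\<^sup>2 + 1 / (2 * ln (2 * exp 1 * real p)))"
      by (simp add: prob_space)
  qed

  have part2: "integrable M (\<lambda>\<omega>. lq_norm q (\<beta>star - \<beta>hat \<omega>) powr q) \<and>
      (\<integral>\<omega>. lq_norm q (\<beta>star - \<beta>hat \<omega>) powr q \<partial>M)
        \<le> 49 powr q * lam powr q * real s / 8 powr q *
            (1 / \<theta> powr (2 * q) + 1 / ln (2 * exp 1 * real p) powr q)"
    if f: "f = X *v \<beta>star" and sparse: "l0_norm \<beta>star \<le> s" and q: "1 \<le> q" "q \<le> 2" for \<beta>star q
  proof -
    \<comment> \<open>Every coordinate is measured in the scale \<open>r\<close> of the claimed bound: \<open>r powr q * s\<close> is its \<open>\<theta>\<close> part.\<close>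
    define r where "r = 49 / 8 * lam / \<theta>\<^sup>2"
    have "r > 0" using tuning(1) \<theta>(1) by (simp add: r_def)
    define G where "G \<omega> = r powr q * (64 / 2401 * \<theta>\<^sup>2 * B \<omega> + 4 / 2401 * \<theta>^4 / real s * (B \<omega>)\<^sup>2
      + 16 / 49 * \<theta>\<^sup>2 * B \<omega>)" for \<omega>
    have le: "AE \<omega> in M. lq_norm q (\<beta>star - \<beta>hat \<omega>) powr q \<le> G \<omega>"
      using pathwise[OF sparse]
    proof eventually_elim
      case (elim \<omega>)
      define u where "u = \<beta>hat \<omega> - \<beta>star"
      have bound: "lam / 2 * lq_norm 1 u + (emp_norm (X *v u))\<^sup>2 \<le> lam\<^sup>2 * B \<omega>"
        using elim by (simp add: f u_def matrix_vector_mult_diff_distrib emp_norm_eq)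
      have l2: "(norm u)\<^sup>2 \<le> lam\<^sup>2 * (B \<omega> / \<theta>\<^sup>2 + (B \<omega>)\<^sup>2 / (16 * real s))"
        using l2_le_of_prediction_and_l1[OF tuning(1) s(1) assms(5) B_nonneg bound] by (simp add: \<theta>_def)
      have "lam / 2 * lq_norm 1 u \<le> lam\<^sup>2 * B \<omega>"
        using bound zero_le_power2[of "emp_norm (X *v u)"] by linarith
      then have "lam * lq_norm 1 u \<le> lam * (2 * lam * B \<omega>)"
        by (simp add: power2_eq_square)
      then have l1: "lq_norm 1 u \<le> 2 * lam * B \<omega>" using tuning(1) by simp
      have "lq_norm q (\<beta>star - \<beta>hat \<omega>) = lq_norm q u"
        by (simp add: lq_norm_def u_def abs_minus_commute)
      also have "\<dots> powr q \<le> r powr q * ((norm u)\<^sup>2 / r\<^sup>2 + lq_norm 1 u / r)"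
        by (rule sum_powr_le_l1_l2[OF q \<open>r > 0\<close>])
      also have "\<dots> \<le> r powr q * (lam\<^sup>2 * (B \<omega> / \<theta>\<^sup>2 + (B \<omega>)\<^sup>2 / (16 * real s)) / r\<^sup>2 + 2 * lam * B \<omega> / r)"
        using l1 l2 \<open>r > 0\<close> by (intro mult_left_mono add_mono divide_right_mono) auto
      also have "lam\<^sup>2 * (B \<omega> / \<theta>\<^sup>2 + (B \<omega>)\<^sup>2 / (16 * real s)) / r\<^sup>2 + 2 * lam * B \<omega> / r
          = 64 / 2401 * \<theta>\<^sup>2 * B \<omega> + 4 / 2401 * \<theta>^4 / real s * (B \<omega>)\<^sup>2 + 16 / 49 * \<theta>\<^sup>2 * B \<omega>"
        using tuning(1) \<theta>(1) s(1) by (simp add: r_def field_simps power2_eq_square power4_eq_xxxx)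
      finally show ?case by (simp add: G_def)
    qed
    have "expectation G = r powr q * (64 / 2401 * \<theta>\<^sup>2 * expectation B
        + 4 / 2401 * \<theta>^4 / real s * expectation (\<lambda>\<omega>. (B \<omega>)\<^sup>2) + 16 / 49 * \<theta>\<^sup>2 * expectation B)"
      unfolding G_def by simp
    also have "\<dots> \<le> r powr q * (64 / 2401 * \<theta>\<^sup>2 * (53 / 20 * real s / \<theta>\<^sup>2)
        + 4 / 2401 * \<theta>^4 / real s * (14 * (real s / \<theta>\<^sup>2)\<^sup>2) + 16 / 49 * \<theta>\<^sup>2 * (53 / 20 * real s / \<theta>\<^sup>2))"
      using B_exp B2_exp by (intro mult_left_mono add_mono) auto
    also have "\<dots> = r powr q * ((64 / 2401 * (53 / 20) + 4 / 2401 * 14 + 16 / 49 * (53 / 20)) * real s)"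
      using \<theta>(1) s(1) by (simp add: field_simps power2_eq_square power4_eq_xxxx)
    also have "\<dots> \<le> r powr q * (1 * real s)"
      by (intro mult_left_mono mult_right_mono) auto
    also have "\<dots> = 49 powr q * lam powr q * real s / 8 powr q * (1 / \<theta> powr (2 * q))"
    proof -
      have "(\<theta>\<^sup>2) powr q = \<theta> powr (2 * q)"
        using \<theta>(1) by (metis powr_numeral powr_powr less_imp_le)
      then show ?thesis
        using tuning(1) \<theta>(1) by (simp add: r_def powr_divide powr_mult)
    qed
    also have "\<dots> \<le> 49 powr q * lam powr q * real s / 8 powr q *
            (1 / \<theta> powr (2 * q) + 1 / ln (2 * exp 1 * real p) powr q)"
      by (intro mult_left_mono) auto
    finally have exp: "expectation G \<le> 49 powr q * lam powr q * real s / 8 powr q *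
            (1 / \<theta> powr (2 * q) + 1 / ln (2 * exp 1 * real p) powr q)" .
    show ?thesis
    proof (rule integrable_expectation_le_AE[OF _ _ le _ exp])
      show "(\<lambda>\<omega>. lq_norm q (\<beta>star - \<beta>hat \<omega>) powr q) \<in> borel_measurable M"
        unfolding lq_norm_def by measurable
      show "integrable M G" unfolding G_def by simp
    qed simp
  qed
  from part1 part2 show ?thesis
    unfolding \<theta>_def p_def by blast
qed

end
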